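(* Let $\kappa>0$ and consider the coupled pendula system $$\ddot x+\sin x=\kappa(y-x),\qquad \ddot y+\sin y=\kappa(x-y).$$ For $E>0$, the synchronous (running) solution $x=y=p(t;E)$ with energy surplus $E$ is linearly unstable if and only if $$E\in(4\kappa-2,\,4\kappa).$$ For all other values of $E>0$ the solution is linearly stable. In particular, for $\kappa>1/2$ the first two terms in the sequence of resonant energies $E_m\downarrow0$ are $E_1=4\kappa$ and $E_2=4\kappa-2$. At all other resonant energies $E_3,E_4,\ldots$ the linearization around the synchronous solution is neutrally stable, i.e. its Floquet matrix $F_E$ is plus or minus the identity.
   Context: For $E>0$, $p(t;E)$ denotes the solution of $\ddot p+\sin p=0$ with $\frac{\dot p^2}{2}-(1+\cos p)=E$, $p(0;E)=0$, $\dot p>0$ (so $E=0$ corresponds to the unstable equilibrium and heteroclinic solutions, and the running solution exists iff $E>0$). It increases by $2\pi$ over a time $T(E)$. The stability of $x=y=p$ is determined by the equation $\ddot w+(2\kappa+\cos p(t;E))w=0$ for the difference $w=\xi-\eta$ of the perturbations of $x$ and $y$. $F_E$ denotes the Floquet matrix of this equation, i.e. the $2\times2$ matrix (of determinant $1$) advancing $(w,\dot w)$ over one period $T(E)$ of the coefficient. The solution is called linearly unstable if $F_E$ is hyperbolic, i.e. $|\operatorname{tr}F_E|>2$, and linearly stable otherwise; it is called strongly stable if the eigenvalues of $F_E$ lie on the unit circle and differ from $\pm1$. For $\kappa>1/2$, the resonant energies are the endpoints $E_1\ge E_2>E_3\ge E_4>\cdots\downarrow0$ of the segments $[E_{2n},E_{2n-1}]$,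 $n\ge1$, whose union is the set of all $E>0$ at which the synchronous solution is not strongly stable. *)

theory Defs
  imports "HOL-Analysis.Analysis"
begin

definition coupled_pendula :: "real \<Rightarrow> (real \<Rightarrow> real) \<Rightarrow> (real \<Rightarrow> real) \<Rightarrow> bool" where
  "coupled_pendula \<kappa> x y \<longleftrightarrow>
     (\<exists>x' y'. \<forall>t.
        (x has_real_derivative x' t) (at t) \<and>
        (x' has_real_derivative \<kappa> * (y t - x t) - sin (x t)) (at t) \<and>
        (y has_real_derivative y' t) (at t) \<and>
        (y' has_real_derivative \<kappa> * (x t - y t) - sin (y t)) (at t))"

definition running_solution :: "real \<Rightarrow> (real \<Rightarrow> real) \<Rightarrow> bool" where
  "running_solution E p \<longleftrightarrow>
     p 0 = 0 \<and>
     (\<exists>p'. \<forall>t.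
        (p has_real_derivative p' t) (at t) \<and>
        (p' has_real_derivative - sin (p t)) (at t) \<and>
        (p' t)\<^sup>2 / 2 - (1 + cos (p t)) = E \<and>
        p' t > 0)"

text \<open>
  The objects \<open>running E\<close>, \<open>period E\<close> and \<open>floquet \<kappa> E\<close> below are definite descriptions. They are
  meaningful for \<open>E > 0\<close>, where existence and uniqueness hold.
\<close>

definition running :: "real \<Rightarrow> real \<Rightarrow> real" where
  "running E = (THE p. running_solution E p)"

definition period :: "real \<Rightarrow> real" where
  "period E = (THE T. \<forall>t. running E (t + T) = running E t + 2 * pi)"

text \<open>
  Linearization of the coupled system around \<open>x = y = p\<close>; here \<open>\<xi>\<close>, \<open>\<eta>\<close> are the perturbations
  of \<open>x\<close>, \<open>y\<close> and \<open>\<xi>'\<close>, \<open>\<eta>'\<close> their velocities.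
\<close>

definition linearized_pendula ::
    "real \<Rightarrow> (real \<Rightarrow> real) \<Rightarrow> (real \<Rightarrow> real) \<Rightarrow> (real \<Rightarrow> real) \<Rightarrow> (real \<Rightarrow> real) \<Rightarrow> (real \<Rightarrow> real) \<Rightarrow> bool" where
  "linearized_pendula \<kappa> p \<xi> \<xi>' \<eta> \<eta>' \<longleftrightarrow>
     (\<forall>t.
        (\<xi> has_real_derivative \<xi>' t) (at t) \<and>
        (\<xi>' has_real_derivative \<kappa> * (\<eta> t - \<xi> t) - cos (p t) * \<xi> t) (at t) \<and>
        (\<eta> has_real_derivative \<eta>' t) (at t) \<and>
        (\<eta>' has_real_derivative \<kappa> * (\<xi> t - \<eta> t) - cos (p t) * \<eta> t) (at t))"

definition difference_solution ::
    "real \<Rightarrow> (real \<Rightarrow> real) \<Rightarrow> (real \<Rightarrow> real) \<Rightarrow> (real \<Rightarrow> real) \<Rightarrow> bool" where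
  "difference_solution \<kappa> p w w' \<longleftrightarrow>
     (\<forall>t.
        (w has_real_derivative w' t) (at t) \<and>
        (w' has_real_derivative - ((2 * \<kappa> + cos (p t)) * w t)) (at t))"

lemma difference_solution_of_linearized:
  assumes "linearized_pendula \<kappa> p \<xi> \<xi>' \<eta> \<eta>'"
  shows "difference_solution \<kappa> p (\<lambda>t. \<xi> t - \<eta> t) (\<lambda>t. \<xi>' t - \<eta>' t)"
  unfolding difference_solution_def
proof (intro allI conjI)
  fix t
  show "((\<lambda>t. \<xi> t - \<eta> t) has_real_derivative \<xi>' t - \<eta>' t) (at t)"
    using assms by (auto simp: linearized_pendula_def intro: DERIV_diff)
  have "((\<lambda>t. \<xi>' t - \<eta>' t) has_real_derivative
      (\<kappa> * (\<eta> t - \<xi> t) - cos (p t) * \<xi> t) - (\<kappa> * (\<xi> t - \<eta> t) - cos (p t) * \<eta> t)) (at t)"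
    using assms unfolding linearized_pendula_def by (intro DERIV_diff) auto
  then show "((\<lambda>t. \<xi>' t - \<eta>' t) has_real_derivative
      - ((2 * \<kappa> + cos (p t)) * (\<xi> t - \<eta> t))) (at t)"
    by (simp add: algebra_simps)
qed

lemma linearized_of_difference_solution:
  assumes "difference_solution \<kappa> p w w'"
  shows "linearized_pendula \<kappa> p (\<lambda>t. w t / 2) (\<lambda>t. w' t / 2) (\<lambda>t. - (w t / 2)) (\<lambda>t. - (w' t / 2))"
  unfolding linearized_pendula_def
proof (intro allI conjI)
  fix t
  have 1: "(w has_real_derivative w' t) (at t)"
    and 2: "(w' has_real_derivative - ((2 * \<kappa> + cos (p t)) * w t)) (at t)"
    using assms by (auto simp: difference_solution_def)
  show 3: "((\<lambda>t. w t / 2) has_real_derivative w' t / 2) (at t)"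
    using 1 by (rule DERIV_cdivide)
  show "((\<lambda>t. - (w t / 2)) has_real_derivative - (w' t / 2)) (at t)"
    using 3 by (rule DERIV_minus)
  show 4: "((\<lambda>t. w' t / 2) has_real_derivative
      \<kappa> * (- (w t / 2) - w t / 2) - cos (p t) * (w t / 2)) (at t)"
    by (rule DERIV_cong[OF DERIV_cdivide[OF 2, of 2]]) (simp add: field_simps)
  show "((\<lambda>t. - (w' t / 2)) has_real_derivative
      \<kappa> * (w t / 2 - - (w t / 2)) - cos (p t) * (- (w t / 2))) (at t)"
    by (rule DERIV_cong[OF DERIV_minus[OF 4]]) (simp add: field_simps)
qed

definition floquet :: "real \<Rightarrow> real \<Rightarrow> real^2^2" where
  "floquet \<kappa> E =
     (THE F. \<forall>w w'. difference_solution \<kappa> (running E) w w' \<longrightarrow>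
        vector [w (period E), w' (period E)] = F *v vector [w 0, w' 0])"

definition linearly_unstable :: "real \<Rightarrow> real \<Rightarrow> bool" where
  "linearly_unstable \<kappa> E \<longleftrightarrow> \<bar>trace (floquet \<kappa> E)\<bar> > 2"

definition linearly_stable :: "real \<Rightarrow> real \<Rightarrow> bool" where
  "linearly_stable \<kappa> E \<longleftrightarrow> \<not> linearly_unstable \<kappa> E"

definition complex_eigenvalue :: "real^2^2 \<Rightarrow> complex \<Rightarrow> bool" where
  "complex_eigenvalue A \<mu> \<longleftrightarrow>
     (\<exists>v :: complex^2. v \<noteq> 0 \<and> (\<chi> i j. complex_of_real (A $ i $ j)) *v v = \<mu> *s v)"

definition strongly_stable :: "real \<Rightarrow> real \<Rightarrow> bool" where
  "strongly_stable \<kappa> E \<longleftrightarrow>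
     (\<forall>\<mu>. complex_eigenvalue (floquet \<kappa> E) \<mu> \<longrightarrow> cmod \<mu> = 1 \<and> \<mu> \<noteq> 1 \<and> \<mu> \<noteq> -1)"

definition neutrally_stable :: "real \<Rightarrow> real \<Rightarrow> bool" where
  "neutrally_stable \<kappa> E \<longleftrightarrow> floquet \<kappa> E = mat 1 \<or> floquet \<kappa> E = - mat 1"

text \<open>The sequence is indexed from 1; the value at index 0 plays no role.\<close>

definition resonant_energies :: "real \<Rightarrow> (nat \<Rightarrow> real) \<Rightarrow> bool" where
  "resonant_energies \<kappa> e \<longleftrightarrow>
     (\<forall>n\<ge>1. e (2 * n - 1) \<ge> e (2 * n) \<and> e (2 * n) > e (2 * n + 1)) \<and>
     e \<longlonglongrightarrow> 0 \<and>
     (\<Union>n\<in>{1..}. {e (2 * n) .. e (2 * n - 1)}) = {E. E > 0 \<and> \<not> strongly_stable \<kappa> E}"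

end

theory Submission
  imports Defs
begin

text \<open>
  Write \<open>q = 2\<kappa> + cos p\<close> and let \<open>F\<close> be the Floquet matrix of \<open>w'' + q w = 0\<close>. Products of two solutions
  satisfy \<open>y''' + 4 q y' + 2 q' y = 0\<close>, and the pendulum equation makes \<open>y = E + 1 - 4\<kappa> + cos p\<close> a
  solution of it: up to normalization this is the Lame equation with a single instability interval.
  Such a \<open>y\<close> yields a quantity that is quadratic in \<open>(w, w')\<close> and constant along every solution. After
  a full turn \<open>p\<close> is again at the bottom, where the quantity is the diagonal form
  \<open>\<alpha> w\<^sup>2 + \<beta> w'\<^sup>2\<close> with \<open>\<alpha> = 2\<kappa> (E - 4\<kappa>)\<close> and \<open>\<beta> = E - (4\<kappa> - 2)\<close>, so \<open>F\<close> preserves this form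
  (\<open>floquet_preserves_form\<close>). A matrix of determinant one that preserves a nonzero diagonal form has
  equal diagonal entries \<open>a\<close>, and its corner entry \<open>b\<close> obeys \<open>\<alpha> b\<^sup>2 = \<beta> (1 - a\<^sup>2)\<close>.

  Outside \<open>[4\<kappa> - 2, 4\<kappa>]\<close> the form is definite, hence \<open>\<bar>a\<bar> \<le> 1\<close>, and \<open>a = \<plusminus>1\<close> forces \<open>F = \<plusminus>1\<close>. At the two
  endpoints the form degenerates and \<open>a = \<plusminus>1\<close>. Inside the interval it is indefinite, hence \<open>\<bar>a\<bar> \<ge> 1\<close>
  with equality only if \<open>b = 0\<close>. Sturm comparison with \<open>sin (p / 2)\<close>, which solves the equation
  with \<open>2\<kappa>\<close> replaced by \<open>E / 2 + 1\<close> and first vanishes after a full turn, shows \<open>b > 0\<close> for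
  \<open>E > 4\<kappa> - 2\<close> (\<open>floquet_upper_right_pos\<close>). So the interior is unstable and all \<open>E > 4\<kappa>\<close> are strongly
  stable.

  For \<open>E < 4\<kappa> - 2\<close> put \<open>B = 4\<kappa> - 1 - E > 1\<close>. Then \<open>y\<close> never vanishes and
  \<open>sqrt (B - cos p) sin \<phi>\<close> with \<open>\<phi>' = \<omega> / (B - cos p)\<close>, \<open>\<omega>\<^sup>2 = 2\<kappa> (B\<^sup>2 - 1)\<close>, is a solution, so that
  \<open>b = 0\<close> exactly when the phase gained in a period is a multiple of \<open>\<pi>\<close>
  (\<open>floquet_upper_right_zero_iff_phase\<close>). Replacing \<open>p\<close> by the angle \<open>s\<close> in which the Poisson kernel
  \<open>sqrt (B\<^sup>2 - 1) / (B - cos p)\<close> becomes uniform turns this phase into an integral over a fixed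
  interval whose integrand is pointwise strictly decreasing in \<open>E\<close>. The phase is therefore continuous and
  strictly decreasing, and it tends to infinity as \<open>E\<close> decreases to 0 because the period does. Hence
  the energies below \<open>4\<kappa> - 2\<close> that are not strongly stable form a sequence decreasing to 0, all with
  \<open>F = \<plusminus>1\<close> (\<open>neutral_energies_enumeration\<close>). These single points, together with the segment
  \<open>[4\<kappa> - 2, 4\<kappa>]\<close>, can be listed as segments with decreasing endpoints in one way only
  (\<open>decreasing_segments_unique\<close>).
\<close>

section \<open>Solutions of \<open>w'' + q w = 0\<close>\<close>

text \<open>
  The antiderivative vanishing at 0 is chosen rather than written as an integral, so that
  negative arguments need no separate treatment.
\<close>

definition primitive :: "(real \<Rightarrow> real) \<Rightarrow> real \<Rightarrow> real" where
  "primitive f = (SOME F. F 0 = 0 \<and> (\<forall>x. (F has_real_derivative f x) (at x)))"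

lemma
  assumes "continuous_on UNIV f"
  shows primitive_0: "primitive f 0 = 0"
    and primitive_deriv: "(primitive f has_real_derivative f x) (at x)"
proof -
  have "\<exists>F. \<forall>x :: real. -\<infinity> < ereal x \<longrightarrow> ereal x < \<infinity> \<longrightarrow> (F has_vector_derivative f x) (at x)"
    using assms by (intro einterval_antiderivative) (auto simp: continuous_on_eq_continuous_at)
  then obtain F where "\<And>x. (F has_real_derivative f x) (at x)"
    by (auto simp: has_real_derivative_iff_has_vector_derivative)
  then have "((\<lambda>x. F x - F 0) has_real_derivative f x) (at x)" for x
    by (auto intro!: derivative_eq_intros)
  then have "\<exists>F. F 0 = 0 \<and> (\<forall>x. (F has_real_derivative f x) (at x))"
    by (intro exI[of _ "\<lambda>x. F x - F 0"]) simp
  then have "primitive f 0 = 0 \<and> (\<forall>x. (primitive f has_real_derivative f x) (at x))"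
    unfolding primitive_def by (rule someI_ex)
  then show "primitive f 0 = 0" "(primitive f has_real_derivative f x) (at x)"
    by auto
qed

text \<open>
  The function \<open>c * exp (m * t)\<close> grows at least as fast as \<open>F\<close> in either direction from 0. A constant
  \<open>K\<close> in front of the exponential in a bound on \<open>f\<close> improves to \<open>K / m\<close> in the bound on \<open>F\<close>; this gain
  makes Picard iteration converge geometrically.
\<close>

lemma exponential_bound_antiderivative:
  fixes F f :: "real \<Rightarrow> real"
  assumes F: "\<And>t. (F has_real_derivative f t) (at t)" and "F 0 = 0"
    and f: "\<And>t. \<bar>f t\<bar> \<le> c * m * exp (m * \<bar>t\<bar>)" and "c \<ge> 0"
  shows "\<bar>F t\<bar> \<le> c * exp (m * \<bar>t\<bar>)"
proof -
  have forward: "\<bar>G t\<bar> \<le> c * exp (m * t)"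
    if G: "\<And>t. (G has_real_derivative g t) (at t)" and "G 0 = 0"
      and g: "\<And>t. \<bar>g t\<bar> \<le> c * m * exp (m * \<bar>t\<bar>)" and "t \<ge> 0" for G g :: "real \<Rightarrow> real" and t
  proof -
    have "c * exp (m * 0) - G 0 \<le> c * exp (m * t) - G t"
    proof (rule DERIV_nonneg_imp_nondecreasing[OF \<open>t \<ge> 0\<close>], intro exI conjI)
      fix x :: real assume "0 \<le> x"
      show "((\<lambda>x. c * exp (m * x) - G x) has_real_derivative c * m * exp (m * x) - g x) (at x)"
        by (auto intro!: derivative_eq_intros G)
      show "0 \<le> c * m * exp (m * x) - g x"
        using g[of x] \<open>0 \<le> x\<close> by auto
    qed
    moreover have "c * exp (m * 0) + G 0 \<le> c * exp (m * t) + G t"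
    proof (rule DERIV_nonneg_imp_nondecreasing[OF \<open>t \<ge> 0\<close>], intro exI conjI)
      fix x :: real assume "0 \<le> x"
      show "((\<lambda>x. c * exp (m * x) + G x) has_real_derivative c * m * exp (m * x) + g x) (at x)"
        by (auto intro!: derivative_eq_intros G)
      show "0 \<le> c * m * exp (m * x) + g x"
        using g[of x] \<open>0 \<le> x\<close> by auto
    qed
    ultimately show ?thesis
      using \<open>G 0 = 0\<close> \<open>c \<ge> 0\<close> by auto
  qed
  show ?thesis
  proof (cases "t \<ge> 0")
    case True
    then show ?thesis
      using forward[of F f, OF F \<open>F 0 = 0\<close> f True] by simp
  next
    case False
    have "((\<lambda>t. F (- t)) has_real_derivative - f (- t)) (at t)" for t
      using F[of "- t"] by (simp add: DERIV_mirror)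
    then have "\<bar>F (- (- t))\<bar> \<le> c * exp (m * (- t))"
      using False f[of "- _"] \<open>F 0 = 0\<close> by (intro forward[of "\<lambda>t. F (- t)" "\<lambda>t. - f (- t)"]) auto
    then show ?thesis
      using False by simp
  qed
qed

definition hill_solution :: "(real \<Rightarrow> real) \<Rightarrow> (real \<Rightarrow> real) \<Rightarrow> (real \<Rightarrow> real) \<Rightarrow> bool" where
  "hill_solution q w w' \<longleftrightarrow>
     (\<forall>t. (w has_real_derivative w' t) (at t) \<and> (w' has_real_derivative - (q t * w t)) (at t))"

text \<open>
  On a bounded interval the exponential is bounded, so the geometric factor gives uniform
  convergence of the series of derivatives and hence termwise differentiation.
\<close>

lemma deriv_uniform_series:
  fixes f :: "nat \<Rightarrow> real \<Rightarrow> real"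
  assumes f: "\<And>n t. (f n has_real_derivative f' n t) (at t)"
    and bound: "\<And>n t. \<bar>f n t\<bar> \<le> K * (1/2) ^ n * exp (m * \<bar>t\<bar>)"
    and bound': "\<And>n t. \<bar>f' n t\<bar> \<le> L * (1/2) ^ n * exp (m * \<bar>t\<bar>)"
    and "m \<ge> 0" "L \<ge> 0"
  shows "((\<lambda>t. \<Sum>n. f n t) has_real_derivative (\<Sum>n. f' n t)) (at t)"
proof (rule has_field_derivative_series'(2)[where S = "ball 0 (\<bar>t\<bar> + 1)" and ?x0.0 = 0])
  show "uniformly_convergent_on (ball 0 (\<bar>t\<bar> + 1)) (\<lambda>n x. \<Sum>i<n. f' i x)"
  proof (rule Weierstrass_m_test')
    show "summable (\<lambda>n. (1/2) ^ n * (L * exp (m * (\<bar>t\<bar> + 1))))"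
      by (intro summable_mult2 summable_geometric) auto
    fix n and x :: real assume "x \<in> ball 0 (\<bar>t\<bar> + 1)"
    then have "\<bar>x\<bar> \<le> \<bar>t\<bar> + 1"
      by auto
    then have "L * (1/2) ^ n * exp (m * \<bar>x\<bar>) \<le> L * (1/2) ^ n * exp (m * (\<bar>t\<bar> + 1))"
      using assms(4,5) by (intro mult_left_mono) (auto intro: mult_left_mono)
    then show "norm (f' n x) \<le> (1/2) ^ n * (L * exp (m * (\<bar>t\<bar> + 1)))"
      using bound'[of n x] by (simp add: mult_ac)
  qed
  show "summable (\<lambda>n. f n 0)"
  proof (rule summable_comparison_test')
    show "summable (\<lambda>n. K * (1/2) ^ n)"
      by (intro summable_mult summable_geometric) auto
    show "norm (f n 0) \<le> K * (1/2) ^ n" for n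
      using bound[of n 0] by simp
  qed
qed (use f in \<open>auto intro: has_field_derivative_at_within\<close>)

text \<open>
  Picard iteration for the first-order system in \<open>(w, w')\<close>, summed as a series. Measured against the
  weight \<open>exp (m * \<bar>t\<bar>)\<close> with \<open>m\<close> twice a Lipschitz constant of the system, every step halves the terms;
  this yields a solution on the whole line at once.
\<close>

lemma hill_solution_exists:
  fixes q :: "real \<Rightarrow> real"
  assumes q: "continuous_on UNIV q" and q_le: "\<And>t. \<bar>q t\<bar> \<le> M"
  obtains w w' where "hill_solution q w w'" "w 0 = a" "w' 0 = b"
proof -
  define m where "m = 2 * (M + 1)"
  define K where "K = \<bar>a\<bar> + \<bar>b\<bar>"
  have M: "M \<ge> 0"
    using q_le[of 0] by linarith
  then have m: "m > 0"
    by (simp add: m_def)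
  have K: "K \<ge> 0"
    by (simp add: K_def)
  define u where "u = rec_nat ((\<lambda>_::real. a), (\<lambda>_::real. b)) (\<lambda>_ (f, g). (primitive g, primitive (\<lambda>t. - (q t * f t))))"
  define f where "f n = fst (u n)" for n
  define g where "g n = snd (u n)" for n
  have simps: "f 0 = (\<lambda>_. a)" "g 0 = (\<lambda>_. b)" "f (Suc n) = primitive (g n)"
    "g (Suc n) = primitive (\<lambda>t. - (q t * f n t))" for n
    by (simp_all add: f_def g_def u_def split: prod.splits)
  have cont: "continuous_on UNIV (f n) \<and> continuous_on UNIV (g n)" for n
  proof (induction n)
    case 0
    then show ?case by (simp add: simps)
  next
    case (Suc n)
    have "continuous_on UNIV (\<lambda>t. - (q t * f n t))"
      using Suc q by (intro continuous_intros) auto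
    then show ?case
      using Suc by (auto simp: simps intro!: DERIV_continuous_on primitive_deriv)
  qed
  have qf: "continuous_on UNIV (\<lambda>t. - (q t * f n t))" for n
    using cont q by (intro continuous_intros) auto
  have f': "(f (Suc n) has_real_derivative g n t) (at t)" and
    g': "(g (Suc n) has_real_derivative - (q t * f n t)) (at t)" and
    init: "f (Suc n) 0 = 0" "g (Suc n) 0 = 0" for n t
    using primitive_deriv[of "g n"] primitive_0[of "g n"] primitive_deriv[OF qf[of n]]
      primitive_0[OF qf[of n]] cont[of n] by (auto simp: simps)
  have bounds: "(\<forall>t. \<bar>f n t\<bar> \<le> K * (1/2) ^ n * exp (m * \<bar>t\<bar>)) \<and>
      (\<forall>t. \<bar>g n t\<bar> \<le> K * (1/2) ^ n * exp (m * \<bar>t\<bar>))" for n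
  proof (induction n)
    case 0
    have "K * 1 \<le> K * exp (m * \<bar>t\<bar>)" for t
      using m K by (intro mult_left_mono) auto
    moreover have "\<bar>a\<bar> \<le> K" "\<bar>b\<bar> \<le> K"
      by (simp_all add: K_def)
    ultimately show ?case
      by (simp add: simps) (meson order_trans)
  next
    case (Suc n)
    have base: "x * (K * (1/2) ^ n * exp (m * \<bar>t\<bar>)) \<le> K * (1/2) ^ Suc n * m * exp (m * \<bar>t\<bar>)"
      if "x \<le> M + 1" for x t
      using mult_right_mono[OF that, of "K * (1/2) ^ n * exp (m * \<bar>t\<bar>)"] K
      by (simp add: m_def algebra_simps)
    have "\<bar>f (Suc n) t\<bar> \<le> K * (1/2) ^ Suc n * exp (m * \<bar>t\<bar>)" for t
    proof (rule exponential_bound_antiderivative[OF f' init(1)])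
      show "\<bar>g n t\<bar> \<le> K * (1/2) ^ Suc n * m * exp (m * \<bar>t\<bar>)" for t
        using Suc base[of 1 t] M by (smt (verit) mult_1)
    qed (use K in auto)
    moreover have "\<bar>g (Suc n) t\<bar> \<le> K * (1/2) ^ Suc n * exp (m * \<bar>t\<bar>)" for t
    proof (rule exponential_bound_antiderivative[OF g' init(2)])
      fix t
      have "\<bar>q t\<bar> * \<bar>f n t\<bar> \<le> \<bar>q t\<bar> * (K * (1/2) ^ n * exp (m * \<bar>t\<bar>))"
        using Suc by (intro mult_left_mono) auto
      also have "\<dots> \<le> K * (1/2) ^ Suc n * m * exp (m * \<bar>t\<bar>)"
        using q_le[of t] by (intro base) auto
      finally show "\<bar>- (q t * f n t)\<bar> \<le> K * (1/2) ^ Suc n * m * exp (m * \<bar>t\<bar>)"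
        by (simp add: abs_mult)
    qed (use K in auto)
    ultimately show ?case by blast
  qed
  define w where "w t = (\<Sum>n. f n t)" for t
  define w' where "w' t = (\<Sum>n. g n t)" for t
  have summable: "summable (\<lambda>n. f n t)" "summable (\<lambda>n. g n t)" for t
  proof -
    have "summable (\<lambda>n. K * (1/2) ^ n * exp (m * \<bar>t\<bar>))"
      by (intro summable_mult summable_mult2 summable_geometric) auto
    then show "summable (\<lambda>n. f n t)" "summable (\<lambda>n. g n t)"
      using bounds by (auto intro: summable_comparison_test')
  qed
  have "((\<lambda>t. \<Sum>n. f (Suc n) t) has_real_derivative w' t) (at t)" for t
    unfolding w'_def
  proof (rule deriv_uniform_series[OF f'])
    show "\<bar>f (Suc n) t\<bar> \<le> (K / 2) * (1/2) ^ n * exp (m * \<bar>t\<bar>)" for n t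
      using bounds[of "Suc n"] by simp
    show "\<bar>g n t\<bar> \<le> K * (1/2) ^ n * exp (m * \<bar>t\<bar>)" for n t
      using bounds[of n] by simp
  qed (use m K in auto)
  moreover have w_eq: "w t = a + (\<Sum>n. f (Suc n) t)" for t
    using suminf_split_head[OF summable(1)[of t]] by (simp add: w_def simps)
  ultimately have "(w has_real_derivative w' t) (at t)" for t
    unfolding w_eq[abs_def] by (auto intro!: derivative_eq_intros)
  moreover have "((\<lambda>t. \<Sum>n. g (Suc n) t) has_real_derivative (\<Sum>n. - (q t * f n t))) (at t)" for t
  proof (rule deriv_uniform_series[OF g'])
    show "\<bar>g (Suc n) t\<bar> \<le> (K / 2) * (1/2) ^ n * exp (m * \<bar>t\<bar>)" for n t
      using bounds[of "Suc n"] by simp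
    show "\<bar>- (q t * f n t)\<bar> \<le> (M * K) * (1/2) ^ n * exp (m * \<bar>t\<bar>)" for n t
      using mult_mono[OF q_le[of t], of "\<bar>f n t\<bar>" "K * (1/2) ^ n * exp (m * \<bar>t\<bar>)"] bounds[of n] M
      by (simp add: abs_mult mult_ac)
  qed (use m K M in auto)
  moreover have "(\<Sum>n. - (q t * f n t)) = - (q t * w t)" for t
    by (simp add: w_def suminf_minus suminf_mult summable summable_mult)
  moreover have w'_eq: "w' t = b + (\<Sum>n. g (Suc n) t)" for t
    using suminf_split_head[OF summable(2)[of t]] by (simp add: w'_def simps)
  ultimately have "hill_solution q w w'"
    unfolding hill_solution_def w'_eq[abs_def] by (auto intro!: derivative_eq_intros)
  moreover have "w 0 = a" "w' 0 = b"
    by (simp_all add: w_eq w'_eq init)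
  ultimately show ?thesis
    using that by blast
qed

text \<open>
  For \<open>q = r\<close> the Wronskian is constant, which gives uniqueness for the initial value problem; for
  \<open>q < r\<close> it is monotone as long as \<open>u\<close> and \<open>v\<close> are positive, which gives Sturm comparison.
\<close>

lemma wronskian_deriv:
  assumes "hill_solution q u u'" "hill_solution r v v'"
  shows "((\<lambda>t. u t * v' t - u' t * v t) has_real_derivative (q t - r t) * u t * v t) (at t)"
  using assms unfolding hill_solution_def
  by (auto intro!: derivative_eq_intros simp: algebra_simps)

lemma wronskian_constant:
  assumes "hill_solution q u u'" "hill_solution q v v'"
  shows "u t * v' t - u' t * v t = u 0 * v' 0 - u' 0 * v 0"
  using wronskian_deriv[OF assms] by (intro DERIV_isconst_all) auto

section \<open>The running solution and its period\<close>

text \<open>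
  The speed of the running solution at angle \<open>x\<close>, from its energy; the time needed to reach the angle
  \<open>x\<close> is the primitive of the reciprocal speed.
\<close>

definition velocity :: "real \<Rightarrow> real \<Rightarrow> real" where
  "velocity E x = sqrt (2 * (E + 1 + cos x))"

lemma velocity_pos: "velocity E x > 0" if "E > 0"
proof -
  have "E + 1 + cos x > 0"
    using that cos_ge_minus_one[of x] by linarith
  then show ?thesis
    by (simp add: velocity_def)
qed

lemma velocity_squared: "(velocity E x)\<^sup>2 = 2 * (E + 1 + cos x)" if "E > 0"
proof -
  have "E + 1 + cos x > 0"
    using that cos_ge_minus_one[of x] by linarith
  then show ?thesis
    by (simp add: velocity_def)
qed

lemma velocity_le: "velocity E x \<le> sqrt (2 * (E + 2))"
  by (simp add: velocity_def)

lemma velocity_periodic: "velocity E (x + 2 * pi) = velocity E x"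
  by (simp add: velocity_def)

lemma velocity_deriv:
  assumes "E > 0"
  shows "(velocity E has_real_derivative - (sin x / velocity E x)) (at x)"
proof -
  have "E + 1 + cos x > 0"
    using assms cos_ge_minus_one[of x] by linarith
  then show ?thesis
    unfolding velocity_def[abs_def]
    by (auto intro!: derivative_eq_intros simp: field_simps)
qed

definition time_map :: "real \<Rightarrow> real \<Rightarrow> real" where
  "time_map E = primitive (\<lambda>x. 1 / velocity E x)"

lemma
  assumes "E > 0"
  shows time_map_0: "time_map E 0 = 0"
    and time_map_deriv: "(time_map E has_real_derivative 1 / velocity E x) (at x)"
proof -
  have "velocity E x \<noteq> 0" for x
    using velocity_pos[OF assms, of x] by simp
  then have "continuous_on UNIV (\<lambda>x. 1 / velocity E x)"
    using velocity_deriv[OF assms] by (intro continuous_intros DERIV_continuous_on) auto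
  from primitive_0[OF this] primitive_deriv[OF this]
  show "time_map E 0 = 0" "(time_map E has_real_derivative 1 / velocity E x) (at x)"
    unfolding time_map_def by auto
qed

lemma continuous_on_time_map: "continuous_on S (time_map E)" if "E > 0"
  using time_map_deriv[OF that] by (meson DERIV_continuous_on has_field_derivative_at_within)

lemma strict_mono_time_map: "strict_mono (time_map E)" if "E > 0"
proof (rule strict_monoI)
  fix x y :: real assume "x < y"
  then show "time_map E x < time_map E y"
    by (rule DERIV_pos_imp_increasing)
      (meson time_map_deriv[OF that] velocity_pos[OF that] zero_less_divide_1_iff)
qed

text \<open>
  The speed is bounded, so the time map grows at least linearly and reaches every value.
\<close>

lemma bij_time_map:
  assumes "E > 0"
  shows "bij (time_map E)"
proof -
  define c where "c = 1 / sqrt (2 * (E + 2))"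
  have c: "c > 0"
    using assms by (simp add: c_def)
  \<comment> \<open>the reciprocal speed is at least \<open>c\<close>\<close>
  have grow: "c * y - c * x \<le> time_map E y - time_map E x" if "x \<le> y" for x y
  proof -
    have "time_map E x - c * x \<le> time_map E y - c * y"
    proof (rule DERIV_nonneg_imp_nondecreasing[OF that], intro exI conjI)
      fix z
      show "((\<lambda>x. time_map E x - c * x) has_real_derivative 1 / velocity E z - c) (at z)"
        by (auto intro!: derivative_eq_intros time_map_deriv[OF assms])
      show "0 \<le> 1 / velocity E z - c"
        using velocity_le[of E z] velocity_pos[OF assms, of z] assms
        by (simp add: c_def divide_simps)
    qed
    then show ?thesis by simp
  qed
  have "\<exists>x. time_map E x = t" for t
  proof -
    define r where "r = \<bar>t\<bar> / c"
    have r: "r \<ge> 0" "c * r = \<bar>t\<bar>"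
      using c by (auto simp: r_def)
    have "time_map E (- r) \<le> t" "t \<le> time_map E r"
      using grow[of "- r" 0] grow[of 0 r] r time_map_0[OF assms] by auto
    then show ?thesis
      using IVT'[of "time_map E" "- r" t r] r continuous_on_time_map[OF assms] by auto
  qed
  then have "surj (time_map E)"
    by (metis surj_def)
  then show ?thesis
    using strict_mono_imp_inj_on[OF strict_mono_time_map[OF assms]] by (simp add: bij_def)
qed

text \<open>
  Separation of variables: along a running solution \<open>p\<close> the energy forces \<open>p' = velocity E p\<close>, so
  \<open>time_map E (p t) - t\<close> is constant. This gives existence and uniqueness together.
\<close>

lemma running_solution_iff_inverse_time_map:
  assumes "E > 0"
  shows "running_solution E p \<longleftrightarrow> p = inv (time_map E)"
proof
  assume "running_solution E p"
  then obtain p' where p0: "p 0 = 0" and p: "\<And>t. (p has_real_derivative p' t) (at t)"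
    and energy: "\<And>t. (p' t)\<^sup>2 / 2 - (1 + cos (p t)) = E" and pos: "\<And>t. p' t > 0"
    unfolding running_solution_def by blast
  have p': "p' t = velocity E (p t)" for t
    using energy[of t] pos[of t] unfolding velocity_def
    by (intro real_sqrt_unique[symmetric]) (auto simp: field_simps)
  have "((\<lambda>t. time_map E (p t) - t) has_real_derivative 0) (at t)" for t
    using DERIV_chain2[OF time_map_deriv[OF assms] p, of t] pos[of t] p'[of t]
    by (auto intro!: derivative_eq_intros)
  then have "time_map E (p t) - t = time_map E (p 0) - 0" for t
    by (intro DERIV_isconst_all[where f = "\<lambda>t. time_map E (p t) - t"]) auto
  then have "time_map E (p t) = t" for t
    using p0 time_map_0[OF assms] by auto
  then show "p = inv (time_map E)"
    using bij_time_map[OF assms] by (metis bij_inv_eq_iff ext)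
next
  assume p: "p = inv (time_map E)"
  have inverse: "time_map E (p t) = t" "p (time_map E x) = x" for t x
    using bij_time_map[OF assms] by (auto simp: p bij_is_surj bij_is_inj surj_f_inv_f inv_f_f)
  have deriv: "(p has_real_derivative velocity E (p t)) (at t)" for t
  proof -
    have "(p has_real_derivative velocity E (p t)) (at (time_map E (p t)))"
      unfolding has_field_derivative_def
    proof (rule has_derivative_inverse_strong[where S = UNIV and f = "time_map E" and x = "p t"])
      show "(time_map E has_derivative (*) (1 / velocity E (p t))) (at (p t))"
        using time_map_deriv[OF assms, of "p t"] by (simp add: has_field_derivative_def)
      show "(*) (1 / velocity E (p t)) \<circ> (*) (velocity E (p t)) = id"
        using velocity_pos[OF assms, of "p t"] by (auto simp: fun_eq_iff)
    qed (use continuous_on_time_map[OF assms] inverse in auto)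
    then show ?thesis by (simp add: inverse)
  qed
  have "((\<lambda>t. velocity E (p t)) has_real_derivative - sin (p t)) (at t)" for t
    using DERIV_chain2[OF velocity_deriv[OF assms] deriv, of t] velocity_pos[OF assms, of "p t"]
    by simp
  moreover have "p 0 = 0"
    using inverse(2)[of 0] time_map_0[OF assms] by simp
  moreover have "(velocity E (p t))\<^sup>2 / 2 - (1 + cos (p t)) = E" for t
    using velocity_squared[OF assms, of "p t"] by (simp add: field_simps)
  ultimately show "running_solution E p"
    unfolding running_solution_def using deriv velocity_pos[OF assms]
    by (intro conjI exI[of _ "\<lambda>t. velocity E (p t)"]) auto
qed

lemma running_eq_inverse_time_map: "running E = inv (time_map E)" if "E > 0"
  by (simp add: running_def running_solution_iff_inverse_time_map[OF that])

lemma running_solution_running: "running_solution E (running E)" if "E > 0"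
  by (simp add: running_eq_inverse_time_map[OF that] running_solution_iff_inverse_time_map[OF that])

lemma
  assumes "E > 0"
  shows time_map_running: "time_map E (running E t) = t"
    and running_time_map: "running E (time_map E x) = x"
  using bij_time_map[OF assms] unfolding running_eq_inverse_time_map[OF assms]
  by (auto simp: bij_is_surj bij_is_inj surj_f_inv_f inv_f_f)

lemma time_map_add_turn:
  assumes "E > 0"
  shows "time_map E (x + 2 * pi) = time_map E x + time_map E (2 * pi)"
proof -
  define f where "f x = time_map E (x + 2 * pi) - time_map E x" for x
  have "(f has_real_derivative 0) (at x)" for x
  proof -
    have "((\<lambda>x. time_map E (x + 2 * pi)) has_real_derivative 1 / velocity E (x + 2 * pi)) (at x)"
      using time_map_deriv[OF assms] DERIV_shift by blast
    from DERIV_diff[OF this time_map_deriv[OF assms, of x]] show ?thesis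
      by (simp add: velocity_periodic f_def[abs_def])
  qed
  then have "f x = f 0"
    by (intro DERIV_isconst_all) auto
  then show ?thesis
    by (simp add: f_def time_map_0[OF assms])
qed

lemma
  assumes "E > 0"
  shows time_map_turn: "time_map E (2 * pi) = period E"
    and running_add_period: "running E (t + period E) = running E t + 2 * pi"
proof -
  have advance: "running E (t + time_map E (2 * pi)) = running E t + 2 * pi" for t
    using running_time_map[OF assms, of "running E t + 2 * pi"]
    by (simp add: time_map_add_turn[OF assms] time_map_running[OF assms])
  have "period E = time_map E (2 * pi)"
    unfolding period_def
  proof (rule the_equality)
    fix T assume "\<forall>t. running E (t + T) = running E t + 2 * pi"
    then have "running E (0 + T) = running E 0 + 2 * pi"
      by blast
    then have "running E T = 2 * pi"
      using running_time_map[OF assms, of 0] time_map_0[OF assms] by simp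
    then show "T = time_map E (2 * pi)"
      using time_map_running[OF assms, of T] by simp
  qed (use advance in auto)
  then show "time_map E (2 * pi) = period E" "running E (t + period E) = running E t + 2 * pi"
    using advance by simp_all
qed

lemma running_0: "running E 0 = 0" if "E > 0"
  using running_solution_running[OF that] by (simp add: running_solution_def)

lemma running_deriv:
  assumes "E > 0"
  shows "(running E has_real_derivative velocity E (running E t)) (at t)"
    and "((\<lambda>t. velocity E (running E t)) has_real_derivative - sin (running E t)) (at t)"
proof -
  obtain p' where p: "\<And>t. (running E has_real_derivative p' t) (at t)"
    and p'': "\<And>t. (p' has_real_derivative - sin (running E t)) (at t)"
    and energy: "\<And>t. (p' t)\<^sup>2 / 2 - (1 + cos (running E t)) = E" and pos: "\<And>t. p' t > 0"
    using running_solution_running[OF assms] unfolding running_solution_def by blast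
  have "p' t = velocity E (running E t)" for t
    using energy[of t] pos[of t] unfolding velocity_def
    by (intro real_sqrt_unique[symmetric]) (auto simp: field_simps)
  then have "p' = (\<lambda>t. velocity E (running E t))" by auto
  with p p'' show "(running E has_real_derivative velocity E (running E t)) (at t)"
    and "((\<lambda>t. velocity E (running E t)) has_real_derivative - sin (running E t)) (at t)"
    by auto
qed

lemma running_period: "running E (period E) = 2 * pi" if "E > 0"
  using running_add_period[OF that, of 0] by (simp add: running_0[OF that])

lemma running_strict_mono: "strict_mono (running E)" if "E > 0"
proof (rule strict_monoI)
  fix s t :: real assume "s < t"
  then show "running E s < running E t"
    by (rule DERIV_pos_imp_increasing) (meson running_deriv(1)[OF that] velocity_pos[OF that])
qed

lemma period_pos: "period E > 0" if "E > 0"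
proof -
  have "running E 0 < running E (period E)"
    using that by (simp add: running_0 running_period)
  then show ?thesis
    using strict_mono_less[OF running_strict_mono[OF that], of 0 "period E"] by simp
qed

text \<open>
  Near the upright position \<open>x = \<pi>\<close> the speed is at most \<open>sqrt 2 * (\<pi> - x + sqrt E)\<close>, since
  \<open>1 + cos x \<le> (\<pi> - x)\<^sup>2\<close>. Integrating the reciprocal of this bound over half a turn gives the logarithm,
  so the period is unbounded as \<open>E\<close> decreases to 0.
\<close>

lemma period_lower_bound:
  assumes "E > 0"
  shows "ln (1 + pi / sqrt E) / sqrt 2 \<le> period E"
proof -
  define e where "e = sqrt E"
  have e: "e > 0" "e\<^sup>2 = E"
    using assms by (auto simp: e_def)
  define f where "f x = - ln (pi - x + e) / sqrt 2" for x
  have "time_map E 0 - f 0 \<le> time_map E pi - f pi"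
  proof (rule DERIV_nonneg_imp_nondecreasing[where a = 0 and b = pi], goal_cases)
    case (2 x)
    have r: "pi - x + e > 0"
      using 2 e by linarith
    have "E + 1 + cos x \<le> (pi - x + e)\<^sup>2"
    proof -
      have "2 * ((pi - x) / 2) = pi - x"
        by simp
      then have "1 + cos x = 2 * (sin ((pi - x) / 2))\<^sup>2"
        using cos_double_sin[of "(pi - x) / 2"] by (simp add: cos_diff del: times_divide_eq_right)
      also have "(sin ((pi - x) / 2))\<^sup>2 \<le> ((pi - x) / 2)\<^sup>2"
        using abs_sin_x_le_abs_x[of "(pi - x) / 2"] by (meson abs_le_square_iff)
      finally have "1 + cos x \<le> (pi - x)\<^sup>2 / 2"
        by (simp add: power_divide)
      then have "1 + cos x \<le> (pi - x)\<^sup>2"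
        using zero_le_power2[of "pi - x"] by linarith
      moreover have "0 \<le> 2 * (pi - x) * e"
        using 2 e by simp
      ultimately show ?thesis
        using e(2) power2_sum[of "pi - x" e] by linarith
    qed
    then have "velocity E x \<le> sqrt (2 * (pi - x + e)\<^sup>2)"
      unfolding velocity_def by (intro real_sqrt_le_mono) simp
    then have v: "velocity E x \<le> sqrt 2 * (pi - x + e)"
      using r by (simp add: real_sqrt_mult)
    show ?case
    proof (intro exI conjI)
      show "((\<lambda>x. time_map E x - f x) has_real_derivative 1 / velocity E x - 1 / (sqrt 2 * (pi - x + e))) (at x)"
        unfolding f_def using r
        by (auto intro!: derivative_eq_intros time_map_deriv[OF assms] simp: divide_inverse mult.commute)
      show "0 \<le> 1 / velocity E x - 1 / (sqrt 2 * (pi - x + e))"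
        using v velocity_pos[OF assms, of x] r by (simp add: frac_le)
    qed
  qed simp
  then have "(ln (pi + e) - ln e) / sqrt 2 \<le> time_map E pi"
    by (simp add: f_def time_map_0[OF assms] diff_divide_distrib)
  also have "ln (pi + e) - ln e = ln (1 + pi / e)"
  proof -
    have "1 + pi / e = (pi + e) / e"
      using e by (simp add: field_simps)
    moreover have "pi + e > 0"
      using e pi_gt_zero by linarith
    ultimately show ?thesis
      using e by (simp add: ln_div)
  qed
  also have "time_map E pi \<le> period E"
    using strict_mono_less_eq[OF strict_mono_time_map[OF assms], of pi "2 * pi"]
    by (simp add: time_map_turn[OF assms])
  finally show ?thesis
    by (simp add: e_def)
qed

section \<open>The Floquet matrix and its invariant form\<close>

lemma difference_solution_iff_hill:
  "difference_solution \<kappa> p w w' \<longleftrightarrow> hill_solution (\<lambda>t. 2 * \<kappa> + cos (p t)) w w'"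
  by (simp add: difference_solution_def hill_solution_def)

lemma difference_solution_exists:
  assumes "E > 0"
  obtains w w' where "difference_solution \<kappa> (running E) w w'" "w 0 = a" "w' 0 = b"
proof -
  have "continuous_on UNIV (running E)"
    using running_deriv(1)[OF assms] by (meson DERIV_continuous_on has_field_derivative_at_within)
  then have "continuous_on UNIV (\<lambda>t. 2 * \<kappa> + cos (running E t))"
    by (intro continuous_intros)
  moreover have "\<bar>2 * \<kappa> + cos (running E t)\<bar> \<le> 2 * \<bar>\<kappa>\<bar> + 1" for t
    using abs_cos_le_one[of "running E t"] by linarith
  ultimately show ?thesis
    using that unfolding difference_solution_iff_hill by (rule hill_solution_exists)
qed

lemma difference_wronskian:
  assumes "difference_solution \<kappa> p u u'" "difference_solution \<kappa> p v v'"
  shows "u t * v' t - u' t * v t = u 0 * v' 0 - u' 0 * v 0"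
  using assms unfolding difference_solution_iff_hill by (rule wronskian_constant)

lemma vector_eq_matrix_mult_2:
  fixes A :: "real^2^2"
  shows "vector [x, y] = A *v vector [u, v] \<longleftrightarrow>
    x = A$1$1 * u + A$1$2 * v \<and> y = A$2$1 * u + A$2$2 * v"
  by (simp add: vec_eq_iff forall_2 matrix_vector_mult_def sum_2)

lemma difference_solution_eq_combination:
  assumes C: "difference_solution \<kappa> p C C'" "C 0 = 1" "C' 0 = 0"
    and S: "difference_solution \<kappa> p S S'" "S 0 = 0" "S' 0 = 1"
    and w: "difference_solution \<kappa> p w w'"
  shows "w t = C t * w 0 + S t * w' 0" "w' t = C' t * w 0 + S' t * w' 0"
proof -
  have CS: "C t * S' t - C' t * S t = 1"
    using difference_wronskian[OF C(1) S(1), of t] C S by simp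
  have wS: "w t * S' t - w' t * S t = w 0"
    using difference_wronskian[OF w S(1), of t] S by simp
  have wC: "w t * C' t - w' t * C t = - w' 0"
    using difference_wronskian[OF w C(1), of t] C by simp
  show "w t = C t * w 0 + S t * w' 0" "w' t = C' t * w 0 + S' t * w' 0"
    using CS wS wC by algebra+
qed

text \<open>
  Every solution is a combination of the two with initial values \<open>(1, 0)\<close> and \<open>(0, 1)\<close>, so exactly one
  matrix satisfies the description of \<open>floquet\<close>.
\<close>

lemma floquet_advances:
  assumes "E > 0" and w: "difference_solution \<kappa> (running E) w w'"
  shows "w (period E) = floquet \<kappa> E $1$1 * w 0 + floquet \<kappa> E $1$2 * w' 0"
    and "w' (period E) = floquet \<kappa> E $2$1 * w 0 + floquet \<kappa> E $2$2 * w' 0"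
proof -
  obtain C C' where C: "difference_solution \<kappa> (running E) C C'" "C 0 = 1" "C' 0 = 0"
    using difference_solution_exists[OF assms(1)] by metis
  obtain S S' where S: "difference_solution \<kappa> (running E) S S'" "S 0 = 0" "S' 0 = 1"
    using difference_solution_exists[OF assms(1)] by metis
  define F :: "real^2^2"
    where "F = vector [vector [C (period E), S (period E)], vector [C' (period E), S' (period E)]]"
  define advances where "advances F \<longleftrightarrow> (\<forall>w w'. difference_solution \<kappa> (running E) w w' \<longrightarrow>
        vector [w (period E), w' (period E)] = F *v vector [w 0, w' 0])" for F :: "real^2^2"
  have F: "advances F"
    unfolding advances_def vector_eq_matrix_mult_2
    using difference_solution_eq_combination[OF C S] by (simp add: F_def)
  have "G = F" if "advances G" for G
  proof -
    have G: "w (period E) = G$1$1 * w 0 + G$1$2 * w' 0 \<and> w' (period E) = G$2$1 * w 0 + G$2$2 * w' 0"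
      if "difference_solution \<kappa> (running E) w w'" for w w'
      using \<open>advances G\<close> that unfolding advances_def vector_eq_matrix_mult_2 by blast
    show ?thesis
      using G[OF C(1)] G[OF S(1)] C S by (simp add: vec_eq_iff forall_2 F_def)
  qed
  with F have "floquet \<kappa> E = F"
    unfolding floquet_def advances_def[symmetric] by (rule the_equality)
  with F w show "w (period E) = floquet \<kappa> E $1$1 * w 0 + floquet \<kappa> E $1$2 * w' 0"
    "w' (period E) = floquet \<kappa> E $2$1 * w 0 + floquet \<kappa> E $2$2 * w' 0"
    unfolding advances_def vector_eq_matrix_mult_2 by auto
qed

lemma floquet_det:
  assumes "E > 0"
  shows "floquet \<kappa> E $1$1 * floquet \<kappa> E $2$2 - floquet \<kappa> E $1$2 * floquet \<kappa> E $2$1 = 1"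
proof -
  obtain C C' where C: "difference_solution \<kappa> (running E) C C'" "C 0 = 1" "C' 0 = 0"
    using difference_solution_exists[OF assms(1)] by metis
  obtain S S' where S: "difference_solution \<kappa> (running E) S S'" "S 0 = 0" "S' 0 = 1"
    using difference_solution_exists[OF assms(1)] by metis
  show ?thesis
    using difference_wronskian[OF C(1) S(1), of "period E"]
      floquet_advances[OF assms C(1)] floquet_advances[OF assms S(1)] C S
    by (simp add: mult.commute)
qed

text \<open>
  If \<open>y\<close> solves \<open>y''' + 4 q y' + 2 q' y = 0\<close>, then \<open>y w'\<^sup>2 - y' w w' + (y'' / 2 + q y) w\<^sup>2\<close> is constant along
  every solution of \<open>w'' + q w = 0\<close>. Among the functions \<open>A + cos p\<close>, the choice \<open>A = E + 1 - 4\<kappa>\<close> solves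
  the third-order equation for \<open>q = 2\<kappa> + cos p\<close>. The quantity \<open>J\<close> in the proof is this invariant with
  the derivatives of \<open>p\<close> eliminated by the pendulum equation and the energy; at both ends of the
  period \<open>cos p = 1\<close>, where it takes the stated diagonal form.
\<close>

lemma difference_invariant:
  assumes "E > 0" and w: "difference_solution \<kappa> (running E) w w'"
  shows "2 * \<kappa> * (E - 4 * \<kappa>) * (w (period E))\<^sup>2 + (E + 2 - 4 * \<kappa>) * (w' (period E))\<^sup>2
    = 2 * \<kappa> * (E - 4 * \<kappa>) * (w 0)\<^sup>2 + (E + 2 - 4 * \<kappa>) * (w' 0)\<^sup>2"
proof -
  define A where "A = E + 1 - 4 * \<kappa>"
  define p where "p = running E"
  define v where "v t = velocity E (p t)" for t
  define J where "J t = (A + cos (p t)) * (w' t * w' t) + sin (p t) * v t * (w t * w' t)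
    + (1 / 2 * (sin (p t) * sin (p t)) + 2 * \<kappa> * (A - cos (p t))) * (w t * w t)" for t
  have p: "(p has_real_derivative v t) (at t)" and v: "(v has_real_derivative - sin (p t)) (at t)" for t
    using running_deriv[OF assms(1)] by (simp_all add: p_def v_def[abs_def])
  have w1: "(w has_real_derivative w' t) (at t)"
    and w2: "(w' has_real_derivative - ((2 * \<kappa> + cos (p t)) * w t)) (at t)" for t
    using w by (auto simp: difference_solution_def p_def)
  have "(J has_real_derivative 0) (at t)" for t
  proof -
    have v2: "v t * v t = 2 * (E + 1 + cos (p t))"
      using velocity_squared[OF assms(1)] by (simp add: v_def power2_eq_square)
    have s2: "sin (p t) * sin (p t) = 1 - cos (p t) * cos (p t)"
      by (simp flip: power2_eq_square add: sin_squared_eq)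
    show ?thesis
      unfolding J_def[abs_def]
      by (rule DERIV_cong, (rule derivative_intros p v w1 w2)+) (use v2 s2 A_def in algebra)
  qed
  then have "J (period E) = J 0"
    by (intro DERIV_isconst_all) auto
  moreover have "cos (p (period E)) = 1" "sin (p (period E)) = 0" "p 0 = 0"
    using running_period[OF assms(1)] running_0[OF assms(1)] by (simp_all add: p_def)
  ultimately show ?thesis
    by (simp add: J_def A_def power2_eq_square algebra_simps)
qed

lemma floquet_preserves_form:
  fixes E \<kappa> :: real
  assumes "E > 0"
  defines "\<alpha> \<equiv> 2 * \<kappa> * (E - 4 * \<kappa>)" and "\<beta> \<equiv> E + 2 - 4 * \<kappa>" and "F \<equiv> floquet \<kappa> E"
  shows "\<alpha> * (F$1$1)\<^sup>2 + \<beta> * (F$2$1)\<^sup>2 = \<alpha>"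
    and "\<alpha> * (F$1$2)\<^sup>2 + \<beta> * (F$2$2)\<^sup>2 = \<beta>"
    and "\<alpha> * F$1$1 * F$1$2 + \<beta> * F$2$1 * F$2$2 = 0"
proof -
  have preserved: "\<alpha> * (F$1$1 * a + F$1$2 * b)\<^sup>2 + \<beta> * (F$2$1 * a + F$2$2 * b)\<^sup>2 = \<alpha> * a\<^sup>2 + \<beta> * b\<^sup>2"
    for a b
  proof -
    obtain w w' where w: "difference_solution \<kappa> (running E) w w'" "w 0 = a" "w' 0 = b"
      using difference_solution_exists[OF assms(1)] by metis
    show ?thesis
      using difference_invariant[OF assms(1) w(1)] floquet_advances[OF assms(1) w(1)] w(2,3)
      by (simp add: \<alpha>_def \<beta>_def F_def)
  qed
  show 1: "\<alpha> * (F$1$1)\<^sup>2 + \<beta> * (F$2$1)\<^sup>2 = \<alpha>" and 2: "\<alpha> * (F$1$2)\<^sup>2 + \<beta> * (F$2$2)\<^sup>2 = \<beta>"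
    using preserved[of 1 0] preserved[of 0 1] by simp_all
  show "\<alpha> * F$1$1 * F$1$2 + \<beta> * F$2$1 * F$2$2 = 0"
    using preserved[of 1 1] 1 2 by (simp add: power2_sum algebra_simps)
qed

text \<open>
  For \<open>Q = diag(\<alpha>, \<beta>)\<close>, invariance \<open>F\<^sup>T Q F = Q\<close> reads \<open>F\<^sup>T Q = Q F\<^sup>-\<^sup>1\<close>, and \<open>F\<^sup>-\<^sup>1\<close> has the diagonal of
  \<open>F\<close> in reverse order. Comparing diagonal entries gives \<open>\<alpha> (a - d) = \<beta> (a - d) = 0\<close>, and \<open>\<alpha>\<close> and \<open>\<beta>\<close>
  do not vanish simultaneously.
\<close>

lemma floquet_diagonal_eq:
  assumes "E > 0"
  shows "floquet \<kappa> E $2$2 = floquet \<kappa> E $1$1"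
proof -
  define \<alpha> \<beta> where "\<alpha> = 2 * \<kappa> * (E - 4 * \<kappa>)" and "\<beta> = E + 2 - 4 * \<kappa>"
  define a b c d where "a = floquet \<kappa> E $1$1" and "b = floquet \<kappa> E $1$2"
    and "c = floquet \<kappa> E $2$1" and "d = floquet \<kappa> E $2$2"
  have det: "a * d - b * c = 1"
    using floquet_det[OF assms] by (simp add: a_def b_def c_def d_def)
  have form: "\<alpha> * a\<^sup>2 + \<beta> * c\<^sup>2 = \<alpha>" "\<alpha> * b\<^sup>2 + \<beta> * d\<^sup>2 = \<beta>" "\<alpha> * a * b + \<beta> * c * d = 0"
    using floquet_preserves_form[OF assms, of \<kappa>] by (simp_all add: \<alpha>_def \<beta>_def a_def b_def c_def d_def)
  have "\<alpha> * (a - d) = 0" "\<beta> * (a - d) = 0"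
    using det form unfolding power2_eq_square by algebra+
  moreover have "\<alpha> \<noteq> 0 \<or> \<beta> \<noteq> 0"
    using assms by (cases "\<kappa> = 0") (auto simp: \<alpha>_def \<beta>_def)
  ultimately show ?thesis
    by (auto simp: a_def d_def)
qed

lemma floquet_off_diagonal:
  assumes "E > 0"
  shows "2 * \<kappa> * (E - 4 * \<kappa>) * (floquet \<kappa> E $1$2)\<^sup>2 = (E + 2 - 4 * \<kappa>) * (1 - (floquet \<kappa> E $1$1)\<^sup>2)"
    and "(E + 2 - 4 * \<kappa>) * (floquet \<kappa> E $2$1)\<^sup>2 = 2 * \<kappa> * (E - 4 * \<kappa>) * (1 - (floquet \<kappa> E $1$1)\<^sup>2)"
  using floquet_preserves_form[OF assms, of \<kappa>]
  by (simp_all add: floquet_diagonal_eq[OF assms] algebra_simps)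

section \<open>Stability in terms of the trace\<close>

lemma linearly_unstable_iff:
  assumes "E > 0"
  shows "linearly_unstable \<kappa> E \<longleftrightarrow> \<bar>floquet \<kappa> E $1$1\<bar> > 1"
  using floquet_diagonal_eq[OF assms, of \<kappa>]
  by (simp add: linearly_unstable_def trace_def sum_2) linarith

text \<open>
  The characteristic equation. If it holds, the rows of \<open>A - \<mu>\<close> are dependent, and a vector
  orthogonal to a nonzero row, if there is one, is an eigenvector.
\<close>

lemma complex_eigenvalue_iff:
  "complex_eigenvalue A \<mu> \<longleftrightarrow>
    (complex_of_real (A$1$1) - \<mu>) * (complex_of_real (A$2$2) - \<mu>)
      = complex_of_real (A$1$2) * complex_of_real (A$2$1)"
    (is "_ \<longleftrightarrow> (?a - \<mu>) * (?d - \<mu>) = ?b * ?c")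
proof -
  have "complex_eigenvalue A \<mu> \<longleftrightarrow>
    (\<exists>x y. (x \<noteq> 0 \<or> y \<noteq> 0) \<and> (?a - \<mu>) * x + ?b * y = 0 \<and> ?c * x + (?d - \<mu>) * y = 0)"
  proof
    assume "complex_eigenvalue A \<mu>"
    then obtain v :: "complex^2" where "v \<noteq> 0"
      "(\<chi> i j. complex_of_real (A $ i $ j)) *v v = \<mu> *s v"
      unfolding complex_eigenvalue_def by blast
    then show "\<exists>x y. (x \<noteq> 0 \<or> y \<noteq> 0) \<and> (?a - \<mu>) * x + ?b * y = 0 \<and> ?c * x + (?d - \<mu>) * y = 0"
      by (intro exI[of _ "v$1"] exI[of _ "v$2"])
        (auto simp: vec_eq_iff forall_2 matrix_vector_mult_def sum_2 algebra_simps)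
  next
    assume "\<exists>x y. (x \<noteq> 0 \<or> y \<noteq> 0) \<and> (?a - \<mu>) * x + ?b * y = 0 \<and> ?c * x + (?d - \<mu>) * y = 0"
    then obtain x y where "x \<noteq> 0 \<or> y \<noteq> 0" "(?a - \<mu>) * x + ?b * y = 0" "?c * x + (?d - \<mu>) * y = 0"
      by blast
    then show "complex_eigenvalue A \<mu>"
      unfolding complex_eigenvalue_def
      by (intro exI[of _ "vector [x, y] :: complex^2"])
        (auto simp: vec_eq_iff forall_2 matrix_vector_mult_def sum_2 algebra_simps)
  qed
  also have "\<dots> \<longleftrightarrow> (?a - \<mu>) * (?d - \<mu>) = ?b * ?c" (is "?L \<longleftrightarrow> ?R")
  proof
    assume ?L
    then obtain x y where xy: "x \<noteq> 0 \<or> y \<noteq> 0" "(?a - \<mu>) * x + ?b * y = 0" "?c * x + (?d - \<mu>) * y = 0"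
      by blast
    then have "((?a - \<mu>) * (?d - \<mu>) - ?b * ?c) * x = 0" "((?a - \<mu>) * (?d - \<mu>) - ?b * ?c) * y = 0"
      by algebra+
    with xy(1) show ?R by auto
  next
    assume R: ?R
    show ?L
    proof (cases "?b = 0 \<and> ?a = \<mu>")
      case True
      show ?thesis
      proof (cases "?c = 0 \<and> ?d = \<mu>")
        case False
        with R True show ?thesis
          by (intro exI[of _ "\<mu> - ?d"] exI[of _ "?c"]) (auto simp: algebra_simps)
      qed (use True in \<open>auto intro: exI[of _ 1]\<close>)
    next
      case False
      with R show ?thesis
        by (intro exI[of _ "?b"] exI[of _ "\<mu> - ?a"]) (auto simp: algebra_simps)
    qed
  qed
  finally show ?thesis .
qed

text \<open>
  The characteristic polynomial is \<open>\<mu>\<^sup>2 - 2 a \<mu> + 1\<close> with \<open>a\<close> half the trace. For \<open>\<bar>a\<bar> < 1\<close> its roots are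
  non-real with product 1. Otherwise it has a real root, and the only real numbers of modulus 1 are the
  excluded values \<open>1\<close> and \<open>-1\<close>.
\<close>

lemma strongly_stable_iff:
  assumes "E > 0"
  shows "strongly_stable \<kappa> E \<longleftrightarrow> \<bar>floquet \<kappa> E $1$1\<bar> < 1"
proof -
  define a where "a = floquet \<kappa> E $1$1"
  have eigenvalue: "complex_eigenvalue (floquet \<kappa> E) \<mu> \<longleftrightarrow> \<mu>\<^sup>2 - 2 * of_real a * \<mu> + 1 = 0" for \<mu>
  proof -
    have "floquet \<kappa> E $1$2 * floquet \<kappa> E $2$1 = a * a - 1"
      using floquet_det[OF assms, of \<kappa>] by (simp add: a_def floquet_diagonal_eq[OF assms])
    then have "complex_of_real (floquet \<kappa> E $1$2) * complex_of_real (floquet \<kappa> E $2$1) = of_real a * of_real a - 1"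
      by (metis of_real_1 of_real_diff of_real_mult)
    then have "(of_real a - \<mu>) * (of_real a - \<mu>) -
        complex_of_real (floquet \<kappa> E $1$2) * complex_of_real (floquet \<kappa> E $2$1)
      = \<mu>\<^sup>2 - 2 * of_real a * \<mu> + 1"
      by (simp add: algebra_simps power2_eq_square)
    then show ?thesis
      unfolding complex_eigenvalue_iff floquet_diagonal_eq[OF assms] a_def[symmetric]
      by (metis right_minus_eq)
  qed
  show ?thesis
  proof
    assume stable: "strongly_stable \<kappa> E"
    show "\<bar>floquet \<kappa> E $1$1\<bar> < 1"
    proof (rule ccontr)
      assume "\<not> ?thesis"
      then have a: "\<bar>a\<bar> \<ge> 1"
        by (simp add: a_def)
      then have "a\<^sup>2 \<ge> 1"
        by (simp add: abs_le_square_iff[of 1 a, simplified])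
      define r where "r = a + sqrt (a\<^sup>2 - 1)"
      have root: "r\<^sup>2 - 2 * a * r + 1 = 0"
        using \<open>a\<^sup>2 \<ge> 1\<close> by (simp add: r_def power2_sum algebra_simps power2_eq_square)
      have "(complex_of_real r)\<^sup>2 - 2 * of_real a * of_real r + 1 = of_real (r\<^sup>2 - 2 * a * r + 1)"
        by simp
      then have "complex_eigenvalue (floquet \<kappa> E) (of_real r)"
        unfolding eigenvalue root by simp
      then have "cmod (of_real r) = 1" "complex_of_real r \<noteq> 1" "complex_of_real r \<noteq> - 1"
        using stable unfolding strongly_stable_def by blast+
      then have "\<bar>r\<bar> = 1" "r \<noteq> 1" "r \<noteq> -1"
        by auto
      then show False by auto
    qed
  next
    assume "\<bar>floquet \<kappa> E $1$1\<bar> < 1"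
    then have a: "\<bar>a\<bar> < 1"
      by (simp add: a_def)
    show "strongly_stable \<kappa> E"
      unfolding strongly_stable_def eigenvalue
    proof (intro allI impI)
      fix \<mu> :: complex assume \<mu>: "\<mu>\<^sup>2 - 2 * of_real a * \<mu> + 1 = 0"
      define x y where "x = Re \<mu>" and "y = Im \<mu>"
      have re: "x\<^sup>2 - y\<^sup>2 - 2 * a * x + 1 = 0" and im: "2 * x * y - 2 * a * y = 0"
        using arg_cong[OF \<mu>, of Re] arg_cong[OF \<mu>, of Im] by (simp_all add: x_def y_def power2_eq_square)
      have "a\<^sup>2 < 1"
        using a by (simp add: abs_square_less_1)
      have "y \<noteq> 0"
      proof
        assume "y = 0"
        then have "(x - a)\<^sup>2 + (1 - a\<^sup>2) = 0"
          using re by (simp add: power2_diff algebra_simps)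
        then show False
          using \<open>a\<^sup>2 < 1\<close> zero_le_power2[of "x - a"] by linarith
      qed
      with im have "x = a" by auto
      with re have "x\<^sup>2 + y\<^sup>2 = 1"
        by (simp add: power2_eq_square)
      then show "cmod \<mu> = 1 \<and> \<mu> \<noteq> 1 \<and> \<mu> \<noteq> - 1"
        using \<open>y \<noteq> 0\<close> by (auto simp: cmod_def x_def y_def)
    qed
  qed
qed

section \<open>The instability interval\<close>

text \<open>
  The slower equation cannot vanish first: at the first zero \<open>m\<close> of \<open>u\<close> the Wronskian \<open>u v' - u' v\<close>
  equals \<open>- u' m * v m \<ge> 0\<close>, although it starts from 0 and strictly decreases while \<open>u\<close> and \<open>v\<close> are
  positive.
\<close>

lemma sturm_comparison_positive:
  assumes u: "hill_solution q u u'" and v: "hill_solution r v v'"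
    and less: "\<And>t. q t < r t"
    and u0: "u 0 = 0" "u' 0 > 0" and v0: "v 0 = 0"
    and v_pos: "\<And>t. 0 < t \<Longrightarrow> t < T \<Longrightarrow> v t > 0" and vT: "v T \<ge> 0" and "T > 0"
  shows "u T > 0"
proof (rule ccontr)
  assume "\<not> u T > 0"
  have du: "(u has_real_derivative u' t) (at t)" for t
    using u by (simp add: hill_solution_def)
  have cont: "continuous_on S u" for S
    using du by (meson DERIV_continuous_on has_field_derivative_at_within)
  obtain d where d: "d > 0" "\<And>h. 0 < h \<Longrightarrow> h < d \<Longrightarrow> u h > 0"
    using DERIV_pos_inc_right[OF du u0(2)] u0(1) by auto
  define X where "X = {min (d / 2) T..T} \<inter> u -` {..0}"
  have "T \<in> X"
    using \<open>\<not> u T > 0\<close> by (simp add: X_def)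
  moreover have "compact X"
    unfolding X_def compact_eq_bounded_closed
    by (auto intro: bounded_Int continuous_closed_preimage cont)
  ultimately obtain m where m: "m \<in> X" "\<And>t. t \<in> X \<Longrightarrow> m \<le> t"
    using compact_attains_inf[of X] by blast
  have m_bounds: "0 < m" "m \<le> T" "u m \<le> 0"
    using m(1) d(1) \<open>T > 0\<close> by (auto simp: X_def)
  have u_pos: "u t > 0" if "0 < t" "t < m" for t
  proof (cases "t < min (d / 2) T")
    case True
    then show ?thesis
      using d that by auto
  next
    case False
    then show ?thesis
      using m(2)[of t] that m_bounds by (force simp: X_def)
  qed
  have "u m = 0"
  proof (rule ccontr)
    assume "u m \<noteq> 0"
    then have "u m < 0" "0 < u (m / 2)"
      using m_bounds u_pos[of "m / 2"] by auto
    then obtain x where x: "m / 2 \<le> x" "x \<le> m" "u x = 0"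
      using IVT2'[of u m 0 "m / 2"] cont m_bounds by auto
    moreover have "x \<noteq> m"
      using x \<open>u m \<noteq> 0\<close> by auto
    ultimately show False
      using u_pos[of x] m_bounds(1) by auto
  qed
  have "u' m \<le> 0"
  proof (rule ccontr)
    assume "\<not> u' m \<le> 0"
    then obtain e where e: "e > 0" "\<And>h. 0 < h \<Longrightarrow> h < e \<Longrightarrow> u (m - h) < u m"
      using DERIV_pos_inc_left[OF du[of m]] by auto
    define h where "h = min (e / 2) (m / 2)"
    have "0 < h" "h < e" "h < m"
      using e(1) m_bounds(1) by (auto simp: h_def)
    then show False
      using e(2)[of h] u_pos[of "m - h"] m_bounds(3) by force
  qed
  have v_nonneg: "v m \<ge> 0"
    using v_pos[of m] vT m_bounds by (cases "m = T") auto
  define W where "W t = u t * v' t - u' t * v t" for t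
  have W': "(W has_real_derivative (q t - r t) * u t * v t) (at t)" for t
    using wronskian_deriv[OF u v] by (simp add: W_def[abs_def])
  have "W m < W 0"
  proof (rule DERIV_neg_imp_decreasing_open[OF m_bounds(1)])
    fix t assume t: "0 < t" "t < m"
    have "(q t - r t) * (u t * v t) < 0"
      using less[of t] u_pos[OF t] v_pos[of t] t m_bounds by (intro mult_neg_pos) auto
    then show "\<exists>y. (W has_real_derivative y) (at t) \<and> y < 0"
      using W'[of t] by (auto simp: mult.assoc)
  next
    show "continuous_on {0..m} W"
      by (rule DERIV_continuous_on, rule has_field_derivative_at_within, rule W')
  qed
  moreover have "W 0 = 0"
    by (simp add: W_def u0 v0)
  moreover have "W m \<ge> 0"
    using \<open>u m = 0\<close> \<open>u' m \<le> 0\<close> v_nonneg by (simp add: W_def mult_nonpos_nonneg)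
  ultimately show False by linarith
qed

text \<open>
  At the energy with \<open>2\<kappa> = E / 2 + 1\<close>, that is \<open>E = 4\<kappa> - 2\<close>, this is a solution of the equation for the
  difference: the lower edge of the instability interval.
\<close>

lemma hill_solution_sin_half:
  assumes "E > 0"
  shows "hill_solution (\<lambda>t. E / 2 + 1 + cos (running E t)) (\<lambda>t. sin (running E t / 2))
    (\<lambda>t. cos (running E t / 2) * (velocity E (running E t) / 2))"
  unfolding hill_solution_def
proof (intro allI conjI)
  fix t
  show "((\<lambda>t. sin (running E t / 2)) has_real_derivative
      cos (running E t / 2) * (velocity E (running E t) / 2)) (at t)"
    by (auto intro!: derivative_eq_intros running_deriv[OF assms])
  define h where "h = running E t / 2"
  define v where "v = velocity E (running E t)"
  have double: "running E t = 2 * h"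
    by (simp add: h_def)
  have "v * v = 2 * (E + 1 + cos (2 * h))"
    using velocity_squared[OF assms, of "running E t"] by (simp add: v_def double power2_eq_square)
  moreover have "cos (2 * h) = 2 * (cos h * cos h) - 1"
    by (simp add: cos_double_cos power2_eq_square)
  moreover have "sin (2 * h) = 2 * sin h * cos h"
    by (rule sin_double)
  ultimately have "- (sin h * (v / 2)) * (v / 2) + cos h * (- sin (2 * h) / 2)
      = - ((E / 2 + 1 + cos (2 * h)) * sin h)"
    by algebra
  moreover have "((\<lambda>t. cos (running E t / 2) * (velocity E (running E t) / 2)) has_real_derivative
      - (sin h * (v / 2)) * (v / 2) + cos h * (- sin (2 * h) / 2)) (at t)"
    by (auto intro!: derivative_eq_intros running_deriv[OF assms] simp: h_def v_def)
  ultimately show "((\<lambda>t. cos (running E t / 2) * (velocity E (running E t) / 2)) has_real_derivative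
      - ((E / 2 + 1 + cos (running E t)) * sin (running E t / 2))) (at t)"
    by (simp add: double)
qed

text \<open>
  The upper right entry is the value after a period of the solution with initial data \<open>(0, 1)\<close>. For
  \<open>2\<kappa> < E / 2 + 1\<close> this solution oscillates more slowly than \<open>sin (p / 2)\<close>, whose first positive zero
  is the end of the period.
\<close>

lemma floquet_upper_right_pos:
  assumes "E > 0" and "E > 4 * \<kappa> - 2"
  shows "floquet \<kappa> E $1$2 > 0"
proof -
  obtain S S' where S: "difference_solution \<kappa> (running E) S S'" "S 0 = 0" "S' 0 = 1"
    using difference_solution_exists[OF assms(1)] by metis
  have "S (period E) > 0"
  proof (rule sturm_comparison_positive[where u = S and T = "period E" and q = "\<lambda>t. 2 * \<kappa> + cos (running E t)"
        and r = "\<lambda>t. E / 2 + 1 + cos (running E t)" and v = "\<lambda>t. sin (running E t / 2)"])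
    show "hill_solution (\<lambda>t. 2 * \<kappa> + cos (running E t)) S S'"
      using S(1) by (simp add: difference_solution_iff_hill)
    show "hill_solution (\<lambda>t. E / 2 + 1 + cos (running E t)) (\<lambda>t. sin (running E t / 2))
        (\<lambda>t. cos (running E t / 2) * (velocity E (running E t) / 2))"
      by (rule hill_solution_sin_half[OF assms(1)])
    show "sin (running E t / 2) > 0" if "0 < t" "t < period E" for t
    proof (rule sin_gt_zero)
      show "0 < running E t / 2" "running E t / 2 < pi"
        using strict_monoD[OF running_strict_mono[OF assms(1)] that(1)]
          strict_monoD[OF running_strict_mono[OF assms(1)] that(2)]
        by (simp_all add: running_0[OF assms(1)] running_period[OF assms(1)])
    qed
  qed (use S assms in \<open>simp_all add: running_0 running_period period_pos\<close>)
  then show ?thesis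
    using floquet_advances(1)[OF assms(1) S(1)] S(2,3) by simp
qed

lemma floquet_instability_interval:
  assumes "\<kappa> > 0" "E > 0" and "4 * \<kappa> - 2 < E" "E < 4 * \<kappa>"
  shows "\<bar>floquet \<kappa> E $1$1\<bar> > 1"
proof -
  have "2 * \<kappa> * (E - 4 * \<kappa>) < 0"
    using assms by (intro mult_pos_neg) auto
  then have "2 * \<kappa> * (E - 4 * \<kappa>) * (floquet \<kappa> E $1$2)\<^sup>2 < 0"
    by (rule mult_neg_pos) (use floquet_upper_right_pos[OF assms(2,3)] in simp)
  then have "(E + 2 - 4 * \<kappa>) * (1 - (floquet \<kappa> E $1$1)\<^sup>2) < 0"
    by (simp add: floquet_off_diagonal(1)[OF assms(2)])
  then have "(floquet \<kappa> E $1$1)\<^sup>2 > 1"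
    using assms by (simp add: mult_less_0_iff)
  then show ?thesis
    by (metis abs_le_square_iff abs_one linorder_not_le one_power2)
qed

lemma floquet_above:
  assumes "\<kappa> > 0" "E > 4 * \<kappa>"
  shows "\<bar>floquet \<kappa> E $1$1\<bar> < 1"
proof -
  have E: "E > 0" "4 * \<kappa> - 2 < E"
    using assms by auto
  have "2 * \<kappa> * (E - 4 * \<kappa>) * (floquet \<kappa> E $1$2)\<^sup>2 > 0"
    using assms floquet_upper_right_pos[OF E] by auto
  then have "(E + 2 - 4 * \<kappa>) * (1 - (floquet \<kappa> E $1$1)\<^sup>2) > 0"
    by (simp add: floquet_off_diagonal(1)[OF E(1)])
  then have "(floquet \<kappa> E $1$1)\<^sup>2 < 1"
    using assms by (simp add: zero_less_mult_iff)
  then show ?thesis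
    by (simp add: abs_square_less_1)
qed

lemma floquet_edge:
  assumes "\<kappa> > 0" "E > 0" and "E = 4 * \<kappa> \<or> E = 4 * \<kappa> - 2"
  shows "\<bar>floquet \<kappa> E $1$1\<bar> = 1"
proof -
  have "(floquet \<kappa> E $1$1)\<^sup>2 = 1"
    using floquet_off_diagonal[OF assms(2), of \<kappa>] assms by auto
  then show ?thesis
    by (simp add: abs_square_eq_1)
qed

text \<open>
  Both coefficients of the invariant form are negative here, so the form is definite and \<open>F\<close> acts as a
  rotation with respect to it.
\<close>

lemma floquet_below:
  assumes "\<kappa> > 0" "E > 0" "E < 4 * \<kappa> - 2"
  shows "\<bar>floquet \<kappa> E $1$1\<bar> \<le> 1"
    and "\<bar>floquet \<kappa> E $1$1\<bar> = 1 \<longleftrightarrow> floquet \<kappa> E $1$2 = 0"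
    and "floquet \<kappa> E $1$2 = 0 \<Longrightarrow> neutrally_stable \<kappa> E"
proof -
  define a where "a = floquet \<kappa> E $1$1"
  note off = floquet_off_diagonal[OF assms(2), of \<kappa>, folded a_def]
  have neg: "2 * \<kappa> * (E - 4 * \<kappa>) < 0"
    using assms by (intro mult_pos_neg) auto
  have neg': "E + 2 - 4 * \<kappa> < 0"
    using assms by linarith
  have "(E + 2 - 4 * \<kappa>) * (1 - a\<^sup>2) \<le> 0"
    unfolding off(1)[symmetric] using neg by (intro mult_nonpos_nonneg[OF less_imp_le]) simp_all
  then have "a\<^sup>2 \<le> 1"
    using neg' by (simp add: mult_le_0_iff)
  then show "\<bar>floquet \<kappa> E $1$1\<bar> \<le> 1"
    by (simp add: abs_square_le_1 a_def)
  have "a\<^sup>2 = 1 \<longleftrightarrow> floquet \<kappa> E $1$2 = 0"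
    using off(1) neg neg' by auto
  then show iff: "\<bar>floquet \<kappa> E $1$1\<bar> = 1 \<longleftrightarrow> floquet \<kappa> E $1$2 = 0"
    by (simp add: abs_square_eq_1 a_def)
  assume 12: "floquet \<kappa> E $1$2 = 0"
  with \<open>a\<^sup>2 = 1 \<longleftrightarrow> _\<close> have "a\<^sup>2 = 1" by simp
  then have 21: "floquet \<kappa> E $2$1 = 0"
    using off(2) neg' \<open>a\<^sup>2 = 1\<close> by auto
  from \<open>a\<^sup>2 = 1\<close> have "a = 1 \<or> a = - 1"
    by (simp add: power2_eq_1_iff)
  then show "neutrally_stable \<kappa> E"
    using 12 21 floquet_diagonal_eq[OF assms(2), of \<kappa>]
    by (auto simp: neutrally_stable_def vec_eq_iff forall_2 mat_def a_def)
qed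

lemma linearly_unstable_iff_energy:
  assumes "\<kappa> > 0" "E > 0"
  shows "linearly_unstable \<kappa> E \<longleftrightarrow> E \<in> {4 * \<kappa> - 2<..<4 * \<kappa>}"
proof -
  consider "4 * \<kappa> - 2 < E" "E < 4 * \<kappa>" | "E > 4 * \<kappa>" | "E = 4 * \<kappa> \<or> E = 4 * \<kappa> - 2" | "E < 4 * \<kappa> - 2"
    by linarith
  then show ?thesis
  proof cases
    case 1
    then show ?thesis
      using floquet_instability_interval[OF assms] by (simp add: linearly_unstable_iff[OF assms(2)])
  next
    case 2
    then show ?thesis
      using floquet_above[OF assms(1)] by (force simp: linearly_unstable_iff[OF assms(2)])
  next
    case 3
    then show ?thesis
      using floquet_edge[OF assms] by (auto simp: linearly_unstable_iff[OF assms(2)])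
  next
    case 4
    then show ?thesis
      using floquet_below(1)[OF assms] by (force simp: linearly_unstable_iff[OF assms(2)])
  qed
qed

lemma not_strongly_stable_energies:
  assumes "\<kappa> > 1 / 2"
  shows "{E. E > 0 \<and> \<not> strongly_stable \<kappa> E} =
    {4 * \<kappa> - 2..4 * \<kappa>} \<union> {E. 0 < E \<and> E < 4 * \<kappa> - 2 \<and> \<not> strongly_stable \<kappa> E}"
proof -
  have "\<kappa> > 0"
    using assms by simp
  have "\<not> strongly_stable \<kappa> E" if band: "4 * \<kappa> - 2 \<le> E" "E \<le> 4 * \<kappa>" for E
  proof -
    have "E > 0"
      using band assms by linarith
    consider "4 * \<kappa> - 2 < E" "E < 4 * \<kappa>" | "E = 4 * \<kappa> \<or> E = 4 * \<kappa> - 2"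
      using band by (cases "E = 4 * \<kappa> \<or> E = 4 * \<kappa> - 2") auto
    then show ?thesis
      using floquet_instability_interval[OF \<open>\<kappa> > 0\<close> \<open>E > 0\<close>] floquet_edge[OF \<open>\<kappa> > 0\<close> \<open>E > 0\<close>]
      by (fastforce simp: strongly_stable_iff[OF \<open>E > 0\<close>])
  qed
  moreover have "strongly_stable \<kappa> E" if "E > 0" "E > 4 * \<kappa>" for E
    using floquet_above[OF \<open>\<kappa> > 0\<close>] that by (simp add: strongly_stable_iff)
  ultimately show ?thesis
    using assms by force
qed

section \<open>The phase below the instability interval\<close>

text \<open>
  Below the instability interval the solutions rotate by \<open>\<integral> \<omega> / (B - cos p) dt\<close> in a period, where
  \<open>B = 4\<kappa> - 1 - E\<close> and \<open>\<omega>\<^sup>2 = 2\<kappa> (B\<^sup>2 - 1)\<close>. The definition states this angle in the variable \<open>s\<close> of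
  \<open>amplitude_angle\<close> below, in which the domain of integration does not change with the energy and
  the integrand is monotone in it.
\<close>

definition phase_rate :: "real \<Rightarrow> real \<Rightarrow> real \<Rightarrow> real" where
  "phase_rate \<kappa> B s = sqrt (\<kappa> / (4 * \<kappa> - (B\<^sup>2 - 1) / (B + cos s)))"

definition phase :: "real \<Rightarrow> real \<Rightarrow> real" where
  "phase \<kappa> E = integral {0..2 * pi} (phase_rate \<kappa> (4 * \<kappa> - 1 - E))"

lemma phase_rate_denominator:
  fixes B s :: real
  assumes "1 < B" "B < 4 * \<kappa> - 1"
  shows "B + cos s > 0" "(B\<^sup>2 - 1) / (B + cos s) < 4 * \<kappa>"
proof -
  show pos: "B + cos s > 0"
    using assms cos_ge_minus_one[of s] by linarith
  have "(B\<^sup>2 - 1) / (B + cos s) \<le> (B\<^sup>2 - 1) / (B - 1)"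
    using assms cos_ge_minus_one[of s] by (intro divide_left_mono mult_pos_pos pos) auto
  also have "\<dots> = B + 1"
    using assms by (simp add: field_simps power2_eq_square)
  finally show "(B\<^sup>2 - 1) / (B + cos s) < 4 * \<kappa>"
    using assms by linarith
qed

text \<open>
  The substitution \<open>p = amplitude_angle B s\<close> is \<open>tan (p / 2) = sqrt ((B - 1) / (B + 1)) * tan (s / 2)\<close>, in a
  form without the singularities of the tangent. It turns \<open>sqrt (B\<^sup>2 - 1) / (B - cos p) dp\<close> into \<open>ds\<close>.
\<close>

definition amplitude_angle :: "real \<Rightarrow> real \<Rightarrow> real" where
  "amplitude_angle B s = (let \<rho> = B - sqrt (B\<^sup>2 - 1) in s - 2 * arctan (\<rho> * sin s / (1 + \<rho> * cos s)))"

text \<open>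
  The derivative follows from \<open>1 + \<rho>\<^sup>2 = 2 B \<rho>\<close>. The cosine is identified without half-angle
  formulas: the claimed cosine \<open>X\<close> and sine \<open>Y\<close> satisfy \<open>X\<^sup>2 + Y\<^sup>2 = 1\<close> and rotate at the same speed as
  the angle, so the scalar product of the two unit vectors stays equal to its initial value 1.
\<close>

lemma amplitude_angle:
  assumes "B > 1"
  shows "(amplitude_angle B has_real_derivative sqrt (B\<^sup>2 - 1) / (B + cos s)) (at s)"
    and "cos (amplitude_angle B s) = (1 + B * cos s) / (B + cos s)"
    and "amplitude_angle B 0 = 0" and "amplitude_angle B (2 * pi) = 2 * pi"
proof -
  \<comment> \<open>\<open>\<rho>\<close> is the root in \<open>(0, 1)\<close> of \<open>x\<^sup>2 - 2 B x + 1\<close>\<close>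
  define r where "r = sqrt (B\<^sup>2 - 1)"
  define \<rho> where "\<rho> = B - r"
  have B1: "B\<^sup>2 > 1"
    using assms by (simp add: one_less_power)
  have r2: "r * r = B * B - 1"
    using B1 by (simp add: r_def power2_eq_square)
  have r: "r > 0" "r < B"
    using B1 assms by (auto simp: r_def intro: real_less_lsqrt)
  have \<rho>2: "1 + \<rho> * \<rho> = 2 * B * \<rho>"
    using r2 by (simp add: \<rho>_def algebra_simps)
  have \<rho>: "\<rho> > 0" "\<rho> < 1"
  proof -
    show "\<rho> > 0"
      using r by (simp add: \<rho>_def)
    have "(B - 1)\<^sup>2 < r\<^sup>2"
      using assms r2 by (simp add: power2_eq_square algebra_simps)
    then have "B - 1 < r"
      using r(1) by (meson less_eq_real_def power2_less_imp_less)
    then show "\<rho> < 1"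
      by (simp add: \<rho>_def)
  qed
  have angle: "amplitude_angle B = (\<lambda>s. s - 2 * arctan (\<rho> * sin s / (1 + \<rho> * cos s)))"
    by (simp add: fun_eq_iff amplitude_angle_def Let_def r_def \<rho>_def)
  have pos: "B + cos s > 0" for s
    using assms cos_ge_minus_one[of s] by linarith
  have deriv: "(amplitude_angle B has_real_derivative r / (B + cos s)) (at s)" for s
  proof -
    define c where "c = cos s"
    define x where "x = sin s"
    have cx: "x * x = 1 - c * c"
      by (simp add: c_def x_def flip: power2_eq_square add: sin_squared_eq)
    have "\<bar>\<rho> * cos s\<bar> \<le> \<rho> * 1"
      using \<rho>(1) by (simp add: abs_mult)
    then have d: "1 + \<rho> * c > 0"
      using \<rho> unfolding c_def by linarith
    define N where "N = \<rho> * x / (1 + \<rho> * c)"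
    have norm: "(1 + \<rho> * c) * (1 + \<rho> * c) * (1 + N\<^sup>2) = 2 * \<rho> * (B + c)"
    proof -
      have "(1 + \<rho> * c) * N = \<rho> * x"
        using d by (simp add: N_def)
      then show ?thesis
        using cx \<rho>2 unfolding power2_eq_square by algebra
    qed
    have "((\<lambda>s. \<rho> * sin s / (1 + \<rho> * cos s)) has_real_derivative
        (\<rho> * c * (1 + \<rho> * c) - \<rho> * x * (- \<rho> * x)) / ((1 + \<rho> * c) * (1 + \<rho> * c))) (at s)"
      unfolding c_def x_def using d[unfolded c_def]
      by (auto intro!: derivative_eq_intros simp: algebra_simps)
    then have "(amplitude_angle B has_real_derivative 1 - 2 * (inverse (1 + N\<^sup>2) *
        ((\<rho> * c * (1 + \<rho> * c) - \<rho> * x * (- \<rho> * x)) / ((1 + \<rho> * c) * (1 + \<rho> * c))))) (at s)"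
      unfolding angle N_def c_def x_def
      by (intro DERIV_diff DERIV_ident DERIV_cmult DERIV_chain2[OF DERIV_arctan])
    also have "inverse (1 + N\<^sup>2) * ((\<rho> * c * (1 + \<rho> * c) - \<rho> * x * (- \<rho> * x)) / ((1 + \<rho> * c) * (1 + \<rho> * c)))
        = (\<rho> * c * (1 + \<rho> * c) - \<rho> * x * (- \<rho> * x)) / ((1 + \<rho> * c) * (1 + \<rho> * c) * (1 + N\<^sup>2))"
      by (simp add: divide_inverse mult_ac)
    also have "\<dots> = (\<rho> * (c + \<rho>)) / (2 * \<rho> * (B + c))"
    proof -
      have "\<rho> * c * (1 + \<rho> * c) - \<rho> * x * (- \<rho> * x) = \<rho> * (c + \<rho>)"
        using cx by algebra
      then show ?thesis
        by (simp only: norm)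
    qed
    also have "1 - 2 * \<dots> = 1 - (2 * \<rho> * (c + \<rho>)) / (2 * \<rho> * (B + c))"
      by (simp only: mult.assoc times_divide_eq_right)
    also have "\<dots> = 1 - (c + \<rho>) / (B + c)"
      using \<rho>(1) by (subst mult_divide_mult_cancel_left) auto
    also have "\<dots> = (B - \<rho>) / (B + c)"
      using pos[of s] by (simp add: c_def field_simps)
    also have "B - \<rho> = r"
      by (simp add: \<rho>_def)
    finally show ?thesis
      by (simp add: c_def)
  qed
  then show "(amplitude_angle B has_real_derivative sqrt (B\<^sup>2 - 1) / (B + cos s)) (at s)"
    by (simp add: r_def)
  show zero: "amplitude_angle B 0 = 0" and "amplitude_angle B (2 * pi) = 2 * pi"
    by (simp_all add: angle)
  define X where "X s = (1 + B * cos s) / (B + cos s)" for s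
  define Y where "Y s = r * sin s / (B + cos s)" for s
  have X': "(X has_real_derivative - (Y s * (r / (B + cos s)))) (at s)" for s
  proof -
    have "(X has_real_derivative
        (- (B * sin s) * (B + cos s) - (1 + B * cos s) * (- sin s)) / ((B + cos s) * (B + cos s))) (at s)"
      unfolding X_def[abs_def] using pos[of s] by (auto intro!: derivative_eq_intros)
    also have "- (B * sin s) * (B + cos s) - (1 + B * cos s) * (- sin s) = - (r * r) * sin s"
      unfolding r2 by (simp add: algebra_simps)
    finally show ?thesis
      by (simp add: Y_def mult_ac)
  qed
  have Y': "(Y has_real_derivative X s * (r / (B + cos s))) (at s)" for s
  proof -
    have "(Y has_real_derivative
        (r * cos s * (B + cos s) - r * sin s * (- sin s)) / ((B + cos s) * (B + cos s))) (at s)"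
      unfolding Y_def[abs_def] using pos[of s] by (auto intro!: derivative_eq_intros)
    also have "r * cos s * (B + cos s) - r * sin s * (- sin s) = (1 + B * cos s) * r"
    proof -
      have "sin s * sin s = 1 - cos s * cos s"
        by (simp flip: power2_eq_square add: sin_squared_eq)
      then show ?thesis by algebra
    qed
    finally show ?thesis
      by (simp add: X_def)
  qed
  have XY: "X s * X s + Y s * Y s = 1" for s
  proof -
    have "X s * (B + cos s) = 1 + B * cos s" "Y s * (B + cos s) = r * sin s"
      using pos[of s] by (simp_all add: X_def Y_def)
    moreover have "sin s * sin s = 1 - cos s * cos s"
      by (simp flip: power2_eq_square add: sin_squared_eq)
    ultimately have "(X s * X s + Y s * Y s - 1) * ((B + cos s) * (B + cos s)) = 0"
      using r2 by algebra
    then show ?thesis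
      using pos[of s] by simp
  qed
  define f where "f s = X s * cos (amplitude_angle B s) + Y s * sin (amplitude_angle B s)" for s
  have "(f has_real_derivative 0) (at s)" for s
    unfolding f_def[abs_def]
    by (auto intro!: derivative_eq_intros X' Y' deriv simp: algebra_simps)
  then have "f s = f 0"
    by (intro DERIV_isconst_all) auto
  also have "f 0 = 1"
    using assms by (simp add: f_def X_def zero field_simps)
  finally have "(X s - cos (amplitude_angle B s))\<^sup>2 + (Y s - sin (amplitude_angle B s))\<^sup>2 = 0"
    using XY[of s] sin_cos_squared_add[of "amplitude_angle B s"]
    unfolding f_def power2_eq_square by (simp add: algebra_simps)
  then have "X s = cos (amplitude_angle B s)"
    by (simp add: sum_power2_eq_zero_iff)
  then show "cos (amplitude_angle B s) = (1 + B * cos s) / (B + cos s)"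
    by (simp add: X_def)
qed

text \<open>
  With \<open>p = amplitude_angle B s\<close> and \<open>t\<close> the time at which the running solution reaches \<open>p\<close>, the chain
  rule turns \<open>\<omega> / (B - cos p) dt\<close> into \<open>phase_rate \<kappa> B s ds\<close>; \<open>s\<close> runs from 0 to \<open>2\<pi>\<close> in a period.
\<close>

lemma elliptic_phase:
  fixes \<kappa> E B :: real
  defines "B \<equiv> 4 * \<kappa> - 1 - E"
  assumes E: "0 < E" "E < 4 * \<kappa> - 2"
  obtains \<phi> where "\<phi> 0 = 0"
    "\<And>t. (\<phi> has_real_derivative sqrt (2 * \<kappa> * (B\<^sup>2 - 1)) / (B - cos (running E t))) (at t)"
    "\<phi> (period E) = phase \<kappa> E"
proof -
  define \<omega> where "\<omega> = sqrt (2 * \<kappa> * (B\<^sup>2 - 1))"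
  have B: "1 < B" "B < 4 * \<kappa> - 1"
    using E by (auto simp: B_def)
  have \<kappa>: "\<kappa> > 0"
    using E by linarith
  define f where "f t = \<omega> / (B - cos (running E t))" for t
  have Y: "B - cos x > 0" for x
    using B(1) cos_le_one[of x] by linarith
  have "continuous_on UNIV (running E)"
    using running_deriv(1)[OF E(1)] by (meson DERIV_continuous_on has_field_derivative_at_within)
  then have f: "continuous_on UNIV f"
    unfolding f_def using Y by (intro continuous_intros) (auto simp: less_imp_neq[symmetric])
  note \<phi> = primitive_0[OF f] primitive_deriv[OF f]
  define h where "h s = primitive f (time_map E (amplitude_angle B s))" for s
  have "(h has_real_derivative phase_rate \<kappa> B s) (at s)" for s
  proof -
    define P where "P = amplitude_angle B s"
    have P: "cos P = (1 + B * cos s) / (B + cos s)"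
      unfolding P_def by (rule amplitude_angle(2)[OF B(1)])
    note den = phase_rate_denominator[OF B, of s]
    have "(h has_real_derivative f (time_map E P) * ((1 / velocity E P) * (sqrt (B\<^sup>2 - 1) / (B + cos s)))) (at s)"
      unfolding h_def[abs_def] P_def
      by (intro DERIV_chain2[OF \<phi>(2)] DERIV_chain2[OF time_map_deriv[OF E(1)]] amplitude_angle(1)[OF B(1)])
    also have "f (time_map E P) = \<omega> / (B - cos P)"
      by (simp add: f_def running_time_map[OF E(1)])
    also have "B - cos P = (B\<^sup>2 - 1) / (B + cos s)"
      using den(1) by (simp add: P field_simps power2_eq_square)
    finally have "(h has_real_derivative
        \<omega> / ((B\<^sup>2 - 1) / (B + cos s)) * ((1 / velocity E P) * (sqrt (B\<^sup>2 - 1) / (B + cos s)))) (at s)" .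
    also have "\<omega> / ((B\<^sup>2 - 1) / (B + cos s)) * ((1 / velocity E P) * (sqrt (B\<^sup>2 - 1) / (B + cos s)))
        = phase_rate \<kappa> B s"
    proof -
      have r: "B\<^sup>2 - 1 > 0"
        using B(1) by (simp add: one_less_power)
      have "E + 1 + cos P = 4 * \<kappa> - (B\<^sup>2 - 1) / (B + cos s)"
        using den(1) by (simp add: P B_def[symmetric] field_simps power2_eq_square) (simp add: B_def algebra_simps)
      then have "velocity E P = sqrt 2 * sqrt (4 * \<kappa> - (B\<^sup>2 - 1) / (B + cos s))"
        by (simp only: velocity_def real_sqrt_mult)
      moreover have "\<omega> = sqrt 2 * sqrt \<kappa> * sqrt (B\<^sup>2 - 1)"
        by (simp add: \<omega>_def real_sqrt_mult)
      moreover have "sqrt (B\<^sup>2 - 1) * sqrt (B\<^sup>2 - 1) = B\<^sup>2 - 1"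
        using r by simp
      ultimately show ?thesis
        using r den by (simp add: phase_rate_def real_sqrt_divide)
    qed
    finally show ?thesis .
  qed
  then have "(phase_rate \<kappa> B has_integral h (2 * pi) - h 0) {0..2 * pi}"
    by (intro fundamental_theorem_of_calculus)
      (auto simp flip: has_real_derivative_iff_has_vector_derivative intro: has_field_derivative_at_within)
  then have "phase \<kappa> E = h (2 * pi) - h 0"
    by (simp add: phase_def B_def integral_unique)
  also have "\<dots> = primitive f (period E)"
    using amplitude_angle(3,4)[OF B(1)]
    by (simp add: h_def time_map_turn[OF E(1)] time_map_0[OF E(1)] \<phi>(1))
  finally show ?thesis
    using that[of "primitive f"] \<phi> by (simp add: f_def[abs_def] \<omega>_def)
qed

text \<open>
  With \<open>R = sqrt (B - cos p)\<close> the function \<open>R sin \<phi>\<close> is a solution that vanishes at 0, hence a nonzero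
  multiple of the solution whose value after a period is the upper right entry.
\<close>

lemma floquet_upper_right_zero_iff_phase:
  assumes E: "0 < E" "E < 4 * \<kappa> - 2"
  shows "floquet \<kappa> E $1$2 = 0 \<longleftrightarrow> sin (phase \<kappa> E) = 0"
proof -
  define B where "B = 4 * \<kappa> - 1 - E"
  define \<omega> where "\<omega> = sqrt (2 * \<kappa> * (B\<^sup>2 - 1))"
  obtain \<phi> where \<phi>0: "\<phi> 0 = 0" and \<phi>T: "\<phi> (period E) = phase \<kappa> E"
    and \<phi>: "\<And>t. (\<phi> has_real_derivative \<omega> / (B - cos (running E t))) (at t)"
    unfolding B_def \<omega>_def by (rule elliptic_phase[OF E]) blast
  have B: "1 < B" "B < 4 * \<kappa> - 1" and \<kappa>: "\<kappa> > 0"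
    using E by (auto simp: B_def)
  have "B\<^sup>2 - 1 > 0"
    using B(1) by (simp add: one_less_power)
  then have \<omega>: "\<omega> > 0" "\<omega> * \<omega> = 2 * \<kappa> * (B * B - 1)"
    using \<kappa> by (simp_all add: \<omega>_def power2_eq_square)
  define p where "p = running E"
  define v where "v t = velocity E (p t)" for t
  have p: "(p has_real_derivative v t) (at t)" and v: "(v has_real_derivative - sin (p t)) (at t)" for t
    using running_deriv[OF E(1)] by (simp_all add: p_def v_def[abs_def])
  define R where "R t = sqrt (B - cos (p t))" for t
  \<comment> \<open>\<open>R\<close> and its inverse \<open>i\<close> make all derivatives below polynomial, so the equation reduces to ideal membership\<close>
  define i where "i t = inverse (R t)" for t
  have Y: "B - cos x > 0" for x
    using B(1) cos_le_one[of x] by linarith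
  have Rpos: "R t > 0" and RR: "R t * R t = B - cos (p t)" and iR: "i t * R t = 1" for t
    using Y[of "p t"] by (simp_all add: R_def i_def)
  have R: "(R has_real_derivative sin (p t) * v t * i t * (1 / 2)) (at t)" for t
    unfolding R_def[abs_def] i_def using Y[of "p t"]
    by (auto intro!: derivative_eq_intros p simp: divide_simps)
  have i: "(i has_real_derivative - (sin (p t) * v t * i t * (1 / 2) * (i t * i t))) (at t)" for t
    unfolding i_def[abs_def] using Rpos[of t]
    by (auto intro!: derivative_eq_intros R simp: i_def power2_eq_square)
  have \<phi>': "(\<phi> has_real_derivative \<omega> * (i t * i t)) (at t)" for t
    using \<phi>[of t] RR[of t] by (simp add: i_def divide_inverse p_def flip: inverse_mult_distrib)
  define w where "w t = R t * sin (\<phi> t)" for t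
  define w' where "w' t = sin (p t) * v t * i t * (1 / 2) * sin (\<phi> t) + \<omega> * i t * cos (\<phi> t)" for t
  have "difference_solution \<kappa> (running E) w w'"
    unfolding difference_solution_def p_def[symmetric]
  proof (intro allI conjI)
    fix t
    show "(w has_real_derivative w' t) (at t)"
      unfolding w_def[abs_def]
      by (rule DERIV_cong, (rule derivative_intros R \<phi>')+) (use iR[of t] w'_def[of t] in algebra)
    have v2: "v t * v t = 2 * (E + 1 + cos (p t))"
      using velocity_squared[OF E(1)] by (simp add: v_def power2_eq_square)
    have s2: "sin (p t) * sin (p t) = 1 - cos (p t) * cos (p t)"
      by (simp flip: power2_eq_square add: sin_squared_eq)
    show "(w' has_real_derivative - ((2 * \<kappa> + cos (p t)) * w t)) (at t)"
      unfolding w'_def[abs_def]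
      by (rule DERIV_cong, (rule derivative_intros p v i \<phi>')+)
        (use v2 s2 iR[of t] RR[of t] \<omega>(2) w_def[of t] B_def in algebra)
  qed
  from floquet_advances(1)[OF E(1) this]
  have "R (period E) * sin (phase \<kappa> E) = floquet \<kappa> E $1$2 * (\<omega> * i 0)"
    by (simp add: w_def w'_def \<phi>0 \<phi>T p_def running_0[OF E(1)])
  moreover have "R (period E) \<noteq> 0" "\<omega> * i 0 \<noteq> 0"
    using Rpos \<omega>(1) by (auto simp: i_def less_imp_neq[symmetric])
  ultimately show ?thesis
    by (metis mult_eq_0_iff)
qed

text \<open>
  The numerator of the difference of \<open>(B\<^sup>2 - 1) / (B + cos s)\<close> at two values \<open>A < B\<close> is \<open>B - A\<close> times
  \<open>A B + 1 + (A + B) cos s\<close>, which is smallest for \<open>cos s = -1\<close>, where it equals \<open>(A - 1) (B - 1) > 0\<close>.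
\<close>

lemma phase_rate_strict_mono:
  assumes "1 < A" "A < B" "B < 4 * \<kappa> - 1"
  shows "phase_rate \<kappa> A s < phase_rate \<kappa> B s"
proof -
  note A = phase_rate_denominator[of A \<kappa> s]
  note B = phase_rate_denominator[of B \<kappa> s]
  have \<kappa>: "\<kappa> > 0"
    using assms by linarith
  have "1 + cos s \<ge> 0"
    using cos_ge_minus_one[of s] by linarith
  then have "(A - 1) * (B - 1) + (1 + cos s) * (A + B) > 0"
    using assms by (intro add_pos_nonneg mult_pos_pos mult_nonneg_nonneg) auto
  then have "(B - A) * ((A - 1) * (B - 1) + (1 + cos s) * (A + B)) > 0"
    using assms by simp
  also have "\<dots> = (B\<^sup>2 - 1) * (A + cos s) - (A\<^sup>2 - 1) * (B + cos s)"
    by (simp add: algebra_simps power2_eq_square)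
  finally have "(A\<^sup>2 - 1) / (A + cos s) < (B\<^sup>2 - 1) / (B + cos s)"
    using A(1) B(1) assms by (simp add: divide_simps mult.commute)
  then show ?thesis
    unfolding phase_rate_def using \<kappa> B(2) assms
    by (intro real_sqrt_less_mono divide_strict_left_mono mult_pos_pos) auto
qed

lemma continuous_on_phase_rate:
  "continuous_on ({1<..<4 * \<kappa> - 1} \<times> S) (\<lambda>(B, s). phase_rate \<kappa> B s)"
proof -
  have "B + cos s \<noteq> 0" "4 * \<kappa> - (B\<^sup>2 - 1) / (B + cos s) \<noteq> 0"
    if "1 < B" "B < 4 * \<kappa> - 1" for B s
    using phase_rate_denominator[OF that, of s] by auto
  then show ?thesis
    unfolding phase_rate_def split_beta by (intro continuous_intros) auto
qed

lemma continuous_on_phase: "continuous_on {0<..<4 * \<kappa> - 2} (phase \<kappa>)"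
proof -
  have "continuous_on {1<..<4 * \<kappa> - 1} (\<lambda>B. integral (cbox 0 (2 * pi)) (phase_rate \<kappa> B))"
    by (rule integral_continuous_on_param[OF continuous_on_phase_rate])
  then have "continuous_on {0<..<4 * \<kappa> - 2}
      (\<lambda>E. integral (cbox 0 (2 * pi)) (phase_rate \<kappa> (4 * \<kappa> - 1 - E)))"
    by (rule continuous_on_compose2) (auto intro!: continuous_intros)
  then show ?thesis
    by (simp add: phase_def[abs_def])
qed

lemma phase_strict_antimono:
  assumes "0 < E" "E < E'" "E' < 4 * \<kappa> - 2"
  shows "phase \<kappa> E' < phase \<kappa> E"
proof -
  have cont: "continuous_on {0..2 * pi} (phase_rate \<kappa> B)" if "1 < B" "B < 4 * \<kappa> - 1" for B
  proof -
    have "continuous_on {0..2 * pi} (\<lambda>s. (\<lambda>(B, s). phase_rate \<kappa> B s) (B, s))"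
      by (rule continuous_on_compose2[OF continuous_on_phase_rate[of \<kappa> UNIV]])
        (use that in \<open>auto intro!: continuous_intros\<close>)
    then show ?thesis by simp
  qed
  show ?thesis
    unfolding phase_def
  proof (rule integral_less_real)
    show "{0<..<2 * pi} \<noteq> {}"
      by (simp add: not_le)
    show "phase_rate \<kappa> (4 * \<kappa> - 1 - E') s < phase_rate \<kappa> (4 * \<kappa> - 1 - E) s" for s
      using assms by (intro phase_rate_strict_mono) auto
  qed (use assms in \<open>auto intro!: cont\<close>)
qed

text \<open>
  The phase grows at the rate \<open>\<omega> / (B - cos p) \<ge> \<omega> / (B + 1)\<close>, and \<open>(\<omega> / (B + 1))\<^sup>2 = 2\<kappa> (B - 1) / (B + 1)\<close> is
  at least \<open>\<kappa> - 1/2\<close> for \<open>2\<kappa> < B < 4\<kappa> - 1\<close>.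
\<close>

lemma phase_lower_bound:
  assumes "0 < E" "E < 2 * \<kappa> - 1"
  shows "sqrt (\<kappa> - 1 / 2) * period E \<le> phase \<kappa> E"
proof -
  define B where "B = 4 * \<kappa> - 1 - E"
  have E: "E < 4 * \<kappa> - 2"
    using assms by linarith
  have B: "2 * \<kappa> < B" "B < 4 * \<kappa> - 1" "1 < B"
    using assms by (auto simp: B_def)
  obtain \<phi> where \<phi>0: "\<phi> 0 = 0" and \<phi>T: "\<phi> (period E) = phase \<kappa> E"
    and \<phi>: "\<And>t. (\<phi> has_real_derivative sqrt (2 * \<kappa> * (B\<^sup>2 - 1)) / (B - cos (running E t))) (at t)"
    unfolding B_def by (rule elliptic_phase[OF assms(1) E]) blast
  define c where "c = sqrt (\<kappa> - 1 / 2)"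
  have "\<phi> 0 - c * 0 \<le> \<phi> (period E) - c * period E"
  proof (rule DERIV_nonneg_imp_nondecreasing[where a = 0 and b = "period E"], goal_cases)
    case 1
    then show ?case
      using period_pos[OF assms(1)] by simp
  next
    case (2 t)
    have "(\<kappa> - 1 / 2) * (B + 1)\<^sup>2 \<le> 2 * \<kappa> * (B\<^sup>2 - 1)"
    proof -
      have "(\<kappa> - 1 / 2) * (B + 1) \<le> (\<kappa> - 1 / 2) * (4 * \<kappa>)"
        using B assms by (intro mult_left_mono) auto
      also have "\<dots> = 2 * \<kappa> * (2 * \<kappa> - 1)"
        by (simp add: algebra_simps)
      also have "\<dots> \<le> 2 * \<kappa> * (B - 1)"
        using B assms by (intro mult_left_mono) auto
      finally have "(\<kappa> - 1 / 2) * (B + 1) * (B + 1) \<le> 2 * \<kappa> * (B - 1) * (B + 1)"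
        using B by (intro mult_right_mono) auto
      also have "2 * \<kappa> * (B - 1) * (B + 1) = 2 * \<kappa> * (B\<^sup>2 - 1)"
        by (simp add: power2_eq_square algebra_simps)
      finally show ?thesis
        by (simp only: power2_eq_square mult.assoc)
    qed
    then have "sqrt ((\<kappa> - 1 / 2) * (B + 1)\<^sup>2) \<le> sqrt (2 * \<kappa> * (B\<^sup>2 - 1))"
      by (rule real_sqrt_le_mono)
    then have c: "c * (B + 1) \<le> sqrt (2 * \<kappa> * (B\<^sup>2 - 1))"
      using B by (simp add: real_sqrt_mult c_def)
    have "c * (B - cos (running E t)) \<le> c * (B + 1)"
      using cos_ge_minus_one[of "running E t"] assms by (intro mult_left_mono) (auto simp: c_def)
    with c have "c \<le> sqrt (2 * \<kappa> * (B\<^sup>2 - 1)) / (B - cos (running E t))"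
      using order_le_less_trans[OF cos_le_one[of "running E t"] B(3)]
      by (subst pos_le_divide_eq) auto
    then show ?case
      by (intro exI[of _ "sqrt (2 * \<kappa> * (B\<^sup>2 - 1)) / (B - cos (running E t)) - c"])
        (auto intro!: derivative_eq_intros \<phi>)
  qed
  then show ?thesis
    by (simp add: \<phi>0 \<phi>T c_def)
qed

lemma phase_unbounded:
  assumes "\<kappa> > 1 / 2"
  obtains E where "0 < E" "E < 2 * \<kappa> - 1" "phase \<kappa> E > M"
proof -
  define c where "c = sqrt (\<kappa> - 1 / 2) / sqrt 2"
  have c: "c > 0"
    using assms by (simp add: c_def)
  define x where "x = \<bar>M\<bar> / c + 1"
  \<comment> \<open>the second bound makes \<open>ln (1 + \<pi> / sqrt E) \<ge> x\<close>, the first one keeps the lower bound on the phase applicable\<close>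
  define E where "E = min (\<kappa> - 1 / 2) ((pi / exp x)\<^sup>2)"
  have E: "0 < E" "E < 2 * \<kappa> - 1"
    using assms by (auto simp: E_def)
  have "sqrt E \<le> sqrt ((pi / exp x)\<^sup>2)"
    by (rule real_sqrt_le_mono) (simp add: E_def)
  then have "sqrt E \<le> pi / exp x"
    by simp
  then have "exp x \<le> pi / sqrt E"
    using E(1) by (simp add: field_simps)
  then have "exp x \<le> 1 + pi / sqrt E"
    by linarith
  then have "x \<le> ln (1 + pi / sqrt E)"
    by (subst ln_ge_iff) (auto intro: order_less_le_trans[OF exp_gt_zero])
  then have "c * x \<le> c * ln (1 + pi / sqrt E)"
    using c by simp
  also have "\<dots> = sqrt (\<kappa> - 1 / 2) * (ln (1 + pi / sqrt E) / sqrt 2)"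
    by (simp add: c_def)
  also have "\<dots> \<le> sqrt (\<kappa> - 1 / 2) * period E"
    using assms by (intro mult_left_mono period_lower_bound[OF E(1)]) simp
  also have "\<dots> \<le> phase \<kappa> E"
    by (rule phase_lower_bound[OF E])
  finally have "c * x \<le> phase \<kappa> E" .
  moreover have "c * x = \<bar>M\<bar> + c"
    using c by (simp add: x_def field_simps)
  ultimately show ?thesis
    using that[OF E] c by linarith
qed

lemma phase_pos:
  assumes "0 < E" "E < 4 * \<kappa> - 2"
  shows "phase \<kappa> E > 0"
proof -
  obtain \<phi> where \<phi>: "\<phi> 0 = 0" "\<phi> (period E) = phase \<kappa> E"
    "\<And>t. (\<phi> has_real_derivative
      sqrt (2 * \<kappa> * ((4 * \<kappa> - 1 - E)\<^sup>2 - 1)) / (4 * \<kappa> - 1 - E - cos (running E t))) (at t)"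
    by (rule elliptic_phase[OF assms]) blast
  have "\<phi> 0 < \<phi> (period E)"
  proof (rule DERIV_pos_imp_increasing[where f = \<phi>])
    fix t
    have "(4 * \<kappa> - 1 - E)\<^sup>2 - 1 > 0"
      using assms by (simp add: one_less_power)
    then have "sqrt (2 * \<kappa> * ((4 * \<kappa> - 1 - E)\<^sup>2 - 1)) / (4 * \<kappa> - 1 - E - cos (running E t)) > 0"
      using assms order_le_less_trans[OF cos_le_one[of "running E t"], of "4 * \<kappa> - 1 - E"]
      by (intro divide_pos_pos) auto
    with \<phi>(3)[of t] show "\<exists>y. (\<phi> has_real_derivative y) (at t) \<and> y > 0"
      by blast
  qed (use period_pos[OF assms(1)] in auto)
  then show ?thesis
    using \<phi> by simp
qed

lemma not_strongly_stable_iff_phase: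
  assumes "0 < E" "E < 4 * \<kappa> - 2"
  shows "\<not> strongly_stable \<kappa> E \<longleftrightarrow> (\<exists>n::nat. phase \<kappa> E = real n * pi)"
proof -
  have "\<kappa> > 0"
    using assms by linarith
  have "\<not> strongly_stable \<kappa> E \<longleftrightarrow> sin (phase \<kappa> E) = 0"
    using floquet_below(1,2)[OF \<open>\<kappa> > 0\<close> assms] floquet_upper_right_zero_iff_phase[OF assms]
    by (auto simp: strongly_stable_iff[OF assms(1)])
  also have "\<dots> \<longleftrightarrow> (\<exists>n::nat. phase \<kappa> E = real n * pi)"
  proof
    assume "sin (phase \<kappa> E) = 0"
    then obtain i :: int where i: "phase \<kappa> E = of_int i * pi"
      by (auto simp: sin_zero_iff_int2)
    then have "i > 0"
      using phase_pos[OF assms] by (simp add: zero_less_mult_iff)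
    then show "\<exists>n::nat. phase \<kappa> E = real n * pi"
      using i by (intro exI[of _ "nat i"]) simp
  qed (auto simp: sin_npi)
  finally show ?thesis .
qed

section \<open>The resonant energies\<close>

text \<open>
  By monotonicity each multiple \<open>n \<pi>\<close> is the phase of at most one energy, and by continuity and
  unboundedness every sufficiently large one is attained. Listing the attained \<open>n\<close> in increasing order
  lists the energies in decreasing order; they tend to 0 because the phase stays below a fixed multiple of
  \<open>\<pi>\<close> on energies bounded away from 0.
\<close>

lemma neutral_energies_enumeration:
  assumes "\<kappa> > 1 / 2"
  shows "\<exists>z::nat \<Rightarrow> real. (\<forall>j k. j < k \<longrightarrow> z k < z j) \<and> z \<longlonglongrightarrow> 0 \<and>
    range z = {E. 0 < E \<and> E < 4 * \<kappa> - 2 \<and> \<not> strongly_stable \<kappa> E}"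
proof -
  define I where "I = {0<..<4 * \<kappa> - 2}"
  define N where "N = {n::nat. \<exists>E\<in>I. phase \<kappa> E = real n * pi}"
  have less_iff: "phase \<kappa> E < phase \<kappa> E' \<longleftrightarrow> E' < E" if "E \<in> I" "E' \<in> I" for E E'
    using phase_strict_antimono[of E E' \<kappa>] phase_strict_antimono[of E' E \<kappa>] that
    by (cases E E' rule: linorder_cases) (auto simp: I_def)
  have N: "n \<in> N" if n: "phase \<kappa> (2 * \<kappa> - 1) \<le> real n * pi" for n
  proof -
    obtain E where E: "0 < E" "E < 2 * \<kappa> - 1" "phase \<kappa> E > real n * pi"
      using phase_unbounded[OF assms] by blast
    have "continuous_on {E..2 * \<kappa> - 1} (phase \<kappa>)"
      by (rule continuous_on_subset[OF continuous_on_phase]) (use E assms in auto)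
    then obtain E' where "E \<le> E'" "E' \<le> 2 * \<kappa> - 1" "phase \<kappa> E' = real n * pi"
      using IVT2'[of "phase \<kappa>" "2 * \<kappa> - 1" "real n * pi" E] n E by auto
    then show ?thesis
      using E assms by (auto simp: N_def I_def)
  qed
  have "infinite N"
    unfolding infinite_nat_iff_unbounded_le
  proof
    fix m
    obtain n where "phase \<kappa> (2 * \<kappa> - 1) / pi \<le> real n"
      using real_arch_simple by blast
    then have "phase \<kappa> (2 * \<kappa> - 1) \<le> real n * pi"
      by (simp add: field_simps)
    also have "\<dots> \<le> real (max m n) * pi"
      by (intro mult_right_mono) auto
    finally show "\<exists>n\<ge>m. n \<in> N"
      using N by (intro exI[of _ "max m n"]) auto
  qed
  have "\<exists>E\<in>I. phase \<kappa> E = real (enumerate N k) * pi" for k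
    using enumerate_in_set[OF \<open>infinite N\<close>, of k] by (auto simp: N_def)
  then obtain z where z: "\<And>k. z k \<in> I" "\<And>k. phase \<kappa> (z k) = real (enumerate N k) * pi"
    by metis
  have "z k < z j" if "j < k" for j k
  proof -
    have "enumerate N j < enumerate N k"
      using that \<open>infinite N\<close> by (rule enumerate_mono)
    then show ?thesis
      using less_iff[OF z(1) z(1), of j k] by (simp add: z(2))
  qed
  moreover have "z \<longlonglongrightarrow> 0"
  proof (rule LIMSEQ_I)
    fix e :: real assume "e > 0"
    define d where "d = min e (2 * \<kappa> - 1)"
    have d: "d \<in> I" "d \<le> e"
      using \<open>e > 0\<close> assms by (auto simp: d_def I_def)
    obtain K where K: "phase \<kappa> d / pi < real K"
      using reals_Archimedean2 by blast
    have "norm (z k - 0) < e" if "K \<le> k" for k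
    proof -
      have "real K \<le> real (enumerate N k)"
        using that le_enumerate[OF \<open>infinite N\<close>, of k] by linarith
      then have "phase \<kappa> d / pi < real (enumerate N k)"
        using K by linarith
      then have "phase \<kappa> d < phase \<kappa> (z k)"
        unfolding z(2) by (simp add: field_simps)
      then have "z k < d"
        using less_iff[OF d(1) z(1)] by blast
      then show ?thesis
        using d(2) z(1)[of k] by (simp add: I_def)
    qed
    then show "\<exists>K. \<forall>k\<ge>K. norm (z k - 0) < e"
      by blast
  qed
  moreover have "range z = {E. 0 < E \<and> E < 4 * \<kappa> - 2 \<and> \<not> strongly_stable \<kappa> E}"
  proof (intro equalityI subsetI)
    fix E assume "E \<in> range z"
    then show "E \<in> {E. 0 < E \<and> E < 4 * \<kappa> - 2 \<and> \<not> strongly_stable \<kappa> E}"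
      using z not_strongly_stable_iff_phase[of E \<kappa>] by (auto simp: I_def)
  next
    fix E assume "E \<in> {E. 0 < E \<and> E < 4 * \<kappa> - 2 \<and> \<not> strongly_stable \<kappa> E}"
    then obtain n :: nat where E: "E \<in> I" "phase \<kappa> E = real n * pi"
      using not_strongly_stable_iff_phase[of E \<kappa>] by (auto simp: I_def)
    then have "n \<in> N"
      by (auto simp: N_def)
    then obtain k where "enumerate N k = n"
      using enumerate_Ex \<open>infinite N\<close> by metis
    then have "phase \<kappa> (z k) = phase \<kappa> E"
      by (simp add: z(2) E(2))
    then have "z k = E"
      using less_iff[OF z(1) E(1)] less_iff[OF E(1) z(1)] by (metis linorder_neq_iff)
    then show "E \<in> range z" by blast
  qed
  ultimately show ?thesis
    by blast
qed

text \<open>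
  The largest point of the union is \<open>e 1\<close>. If \<open>e 2\<close> exceeded \<open>a\<close>, points of \<open>{a..b}\<close> just below it
  would lie in no segment; if it were smaller, the countable set \<open>Z\<close> would contain an interval.
  All later endpoints are then below \<open>a\<close>.
\<close>

lemma decreasing_segments_unique:
  fixes e :: "nat \<Rightarrow> real"
  assumes decreasing: "\<forall>n\<ge>1. e (2 * n - 1) \<ge> e (2 * n) \<and> e (2 * n) > e (2 * n + 1)"
    and union: "(\<Union>n\<in>{1..}. {e (2 * n)..e (2 * n - 1)}) = {a..b} \<union> Z"
    and "a < b" and below: "Z \<subseteq> {..<a}" and "countable Z"
  shows "e 1 = b" "e 2 = a" "m \<ge> 3 \<Longrightarrow> e m \<in> Z"
proof -
  let ?U = "\<Union>n\<in>{1..}. {e (2 * n)..e (2 * n - 1)}"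
  have in_segment: "\<exists>n\<ge>1. e m \<in> {e (2 * n)..e (2 * n - 1)} \<and> e (Suc m) \<le> e m" if "m \<ge> 1" for m
  proof (cases "even m")
    case True
    then obtain n where n: "m = 2 * n" by blast
    then have "n \<ge> 1" using that by simp
    then show ?thesis
      using decreasing[rule_format, of n] by (intro exI[of _ n]) (auto simp: n)
  next
    case False
    then obtain k where "m = 2 * k + 1" by (rule oddE)
    then have m: "m = 2 * (k + 1) - 1" "Suc m = 2 * (k + 1)" by auto
    show ?thesis
      using decreasing[rule_format, of "k + 1"] unfolding m by (intro exI[of _ "k + 1"]) auto
  qed
  have mem: "e m \<in> {a..b} \<union> Z" if "m \<ge> 1" for m
  proof -
    have "e m \<in> ?U"
      using in_segment[OF that] by auto
    then show ?thesis
      unfolding union .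
  qed
  have antimono: "e j \<le> e i" if "1 \<le> i" "i \<le> j" for i j
    using that(2)
  proof (induction j rule: dec_induct)
    case (step j)
    then show ?case
      using in_segment[of j] that(1) by force
  qed simp
  show e1: "e 1 = b"
  proof (rule antisym)
    show "e 1 \<le> b"
      using mem[of 1] below \<open>a < b\<close> by auto
    have "b \<in> ?U"
      unfolding union using \<open>a < b\<close> by simp
    then obtain n where n: "n \<ge> 1" "b \<le> e (2 * n - 1)"
      by auto
    have "e (2 * n - 1) \<le> e 1"
      using n(1) by (intro antimono) auto
    with n(2) show "b \<le> e 1"
      by linarith
  qed
  have e32: "e 3 < e 2"
    using decreasing[rule_format, of 1] by (simp add: numeral_3_eq_3)
  have e21: "e 2 \<le> e 1"
    using antimono[of 1 2] by simp
  show e2: "e 2 = a"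
  proof (rule antisym)
    show "e 2 \<le> a"
    proof (rule ccontr)
      assume "\<not> e 2 \<le> a"
      then obtain y where y: "max a (e 3) < y" "y < e 2"
        using dense[of "max a (e 3)" "e 2"] e32 by auto
      then have "y \<in> {a..b} \<union> Z"
        using e21 e1 by auto
      then have "y \<in> ?U"
        unfolding union .
      then obtain n where n: "n \<ge> 1" "e (2 * n) \<le> y" "y \<le> e (2 * n - 1)"
        by auto
      show False
      proof (cases "n = 1")
        case True
        then show False using n y by simp
      next
        case False
        then have "e (2 * n - 1) \<le> e 3"
          using n(1) by (intro antimono) auto
        then show False
          using n y by simp
      qed
    qed
    show "a \<le> e 2"
    proof (rule ccontr)
      assume "\<not> a \<le> e 2"
      then have "{e 2<..<a} \<subseteq> Z"
      proof (intro subsetI)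
        fix y assume y: "y \<in> {e 2<..<a}"
        then have "y \<in> {e (2 * 1)..e (2 * 1 - 1)}"
          using e1 \<open>a < b\<close> by simp
        then have "y \<in> ?U"
          by blast
        then show "y \<in> Z"
          unfolding union using y by auto
      qed
      then have "countable {e 2<..<a}"
        using \<open>countable Z\<close> countable_subset by blast
      then show False
        using uncountable_open_interval[of "e 2" a] \<open>\<not> a \<le> e 2\<close> by simp
    qed
  qed
  show "e m \<in> Z" if "m \<ge> 3"
    using mem[of m] antimono[of 3 m] e32 e2 that by auto
qed

lemma resonant_energies_exist:
  assumes "\<kappa> > 1 / 2"
  shows "\<exists>e. resonant_energies \<kappa> e"
proof -
  obtain z :: "nat \<Rightarrow> real" where z: "\<And>j k. j < k \<Longrightarrow> z k < z j" "z \<longlonglongrightarrow> 0"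
    and range_z: "range z = {E. 0 < E \<and> E < 4 * \<kappa> - 2 \<and> \<not> strongly_stable \<kappa> E}"
    using neutral_energies_enumeration[OF assms] by blast
  \<comment> \<open>the point \<open>z k\<close> is the segment with number \<open>k + 2\<close>, whose endpoints have the indices \<open>2 k + 3\<close> and \<open>2 k + 4\<close>\<close>
  define e where
    "e m = (if m \<le> 1 then 4 * \<kappa> else if m = 2 then 4 * \<kappa> - 2 else z ((m - 3) div 2))" for m
  have z_less: "z k < 4 * \<kappa> - 2" for k
    using range_z by (metis (mono_tags, lifting) mem_Collect_eq rangeI)
  have e_first: "e (2 * 1) = 4 * \<kappa> - 2" "e (2 * 1 - 1) = 4 * \<kappa>"
    by (simp_all add: e_def)
  have e_rest: "e (2 * (k + 2)) = z k" "e (2 * (k + 2) - 1) = z k" for k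
    by (auto simp: e_def)
  have "e (2 * n) \<le> e (2 * n - 1) \<and> e (2 * n + 1) < e (2 * n)" if "n \<ge> 1" for n
  proof (cases "n = 1")
    case True
    then show ?thesis
      using z_less[of 0] by (simp add: e_def)
  next
    case False
    define k where "k = n - 2"
    have n: "n = k + 2"
      using that False by (simp add: k_def)
    have next_index: "2 * n + 1 = 2 * (Suc k + 2) - 1"
      by (simp add: n)
    have "z (Suc k) < z k"
      by (rule z(1)) simp
    then show ?thesis
      unfolding next_index e_rest unfolding n e_rest by simp
  qed
  moreover have "e \<longlonglongrightarrow> 0"
  proof -
    have "filterlim (\<lambda>m::nat. (m - 3) div 2) sequentially sequentially"
      unfolding filterlim_at_top
    proof
      fix K
      show "\<forall>\<^sub>F m in sequentially. K \<le> (m - 3) div 2"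
        using eventually_ge_at_top[of "2 * K + 3"] by eventually_elim auto
    qed
    then have "(\<lambda>m. z ((m - 3) div 2)) \<longlonglongrightarrow> 0"
      by (rule filterlim_compose[OF z(2)])
    moreover have "\<forall>\<^sub>F m in sequentially. z ((m - 3) div 2) = e m"
      using eventually_ge_at_top[of 3] by eventually_elim (auto simp: e_def)
    ultimately show ?thesis
      by (rule Lim_transform_eventually)
  qed
  moreover have "(\<Union>n\<in>{1..}. {e (2 * n)..e (2 * n - 1)}) = {E. E > 0 \<and> \<not> strongly_stable \<kappa> E}"
  proof -
    have "{1::nat..} = insert 1 (range (\<lambda>k. k + 2))"
    proof (intro equalityI subsetI)
      fix n :: nat assume "n \<in> {1..}"
      then show "n \<in> insert 1 (range (\<lambda>k. k + 2))"
        by (cases "n = 1") (auto simp: image_iff intro!: exI[of _ "n - 2"])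
    qed auto
    then have "(\<Union>n\<in>{1..}. {e (2 * n)..e (2 * n - 1)}) = {4 * \<kappa> - 2..4 * \<kappa>} \<union> range z"
      by (simp only: UN_insert e_first image_image e_rest atLeastAtMost_singleton UN_singleton
          UNION_singleton_eq_range)
    then show ?thesis
      unfolding not_strongly_stable_energies[OF assms] range_z .
  qed
  ultimately show ?thesis
    unfolding resonant_energies_def by blast
qed

lemma resonant_energies_values:
  assumes "\<kappa> > 1 / 2" and e: "resonant_energies \<kappa> e"
  shows "e 1 = 4 * \<kappa>" "e 2 = 4 * \<kappa> - 2" "m \<ge> 3 \<Longrightarrow> neutrally_stable \<kappa> (e m)"
proof -
  define Z where "Z = {E. 0 < E \<and> E < 4 * \<kappa> - 2 \<and> \<not> strongly_stable \<kappa> E}"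
  obtain z :: "nat \<Rightarrow> real" where "range z = Z"
    using neutral_energies_enumeration[OF assms(1)] unfolding Z_def by blast
  then have countable: "countable Z"
    using countable_image[OF countableI_type, of z UNIV] by simp
  have union: "(\<Union>n\<in>{1..}. {e (2 * n)..e (2 * n - 1)}) = {4 * \<kappa> - 2..4 * \<kappa>} \<union> Z"
    using e unfolding resonant_energies_def not_strongly_stable_energies[OF assms(1)] Z_def by blast
  have decreasing: "\<forall>n\<ge>1. e (2 * n - 1) \<ge> e (2 * n) \<and> e (2 * n) > e (2 * n + 1)"
    using e by (simp add: resonant_energies_def)
  have below: "Z \<subseteq> {..<4 * \<kappa> - 2}" and "4 * \<kappa> - 2 < 4 * \<kappa>"
    by (auto simp: Z_def)
  note segments = decreasing_segments_unique[OF decreasing union \<open>4 * \<kappa> - 2 < 4 * \<kappa>\<close> below countable]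
  show "e 1 = 4 * \<kappa>" "e 2 = 4 * \<kappa> - 2"
    by (fact segments)+
  show "neutrally_stable \<kappa> (e m)" if "m \<ge> 3"
  proof -
    have E: "0 < e m" "e m < 4 * \<kappa> - 2" "\<not> strongly_stable \<kappa> (e m)" and "\<kappa> > 0"
      using segments(3)[OF that] assms(1) by (auto simp: Z_def)
    have "\<bar>floquet \<kappa> (e m) $1$1\<bar> = 1"
      using E(3) floquet_below(1)[OF \<open>\<kappa> > 0\<close> E(1,2)] by (simp add: strongly_stable_iff[OF E(1)])
    then show ?thesis
      using floquet_below(2,3)[OF \<open>\<kappa> > 0\<close> E(1,2)] by blast
  qed
qed

lemma coupled_pendula_synchronous:
  assumes "running_solution E p"
  shows "coupled_pendula \<kappa> p p"
proof -
  obtain p' where "\<And>t. (p has_real_derivative p' t) (at t)"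
    "\<And>t. (p' has_real_derivative - sin (p t)) (at t)"
    using assms unfolding running_solution_def by blast
  then show ?thesis
    unfolding coupled_pendula_def by (intro exI[of _ p']) simp
qed

theorem theorem5:
  fixes \<kappa> :: real
  assumes "\<kappa> > 0"
  shows "(\<forall>E>0. coupled_pendula \<kappa> (running E) (running E)) \<and>
    (\<forall>E>0. linearly_unstable \<kappa> E \<longleftrightarrow> E \<in> {4 * \<kappa> - 2 <..< 4 * \<kappa>}) \<and>
    (\<forall>E>0. E \<notin> {4 * \<kappa> - 2 <..< 4 * \<kappa>} \<longrightarrow> linearly_stable \<kappa> E) \<and>
    (\<kappa> > 1 / 2 \<longrightarrow>
      (\<exists>e. resonant_energies \<kappa> e) \<and>
      (\<forall>e. resonant_energies \<kappa> e \<longrightarrow>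
        e 1 = 4 * \<kappa> \<and> e 2 = 4 * \<kappa> - 2 \<and> (\<forall>m\<ge>3. neutrally_stable \<kappa> (e m))))"
proof (intro conjI allI impI)
  fix E :: real assume E: "E > 0"
  show "coupled_pendula \<kappa> (running E) (running E)"
    by (rule coupled_pendula_synchronous[OF running_solution_running[OF E]])
  show unstable: "linearly_unstable \<kappa> E \<longleftrightarrow> E \<in> {4 * \<kappa> - 2 <..< 4 * \<kappa>}"
    by (rule linearly_unstable_iff_energy[OF assms E])
  show "linearly_stable \<kappa> E" if "E \<notin> {4 * \<kappa> - 2 <..< 4 * \<kappa>}"
    using that by (simp add: linearly_stable_def unstable)
next
  assume \<kappa>: "\<kappa> > 1 / 2"
  show "\<exists>e. resonant_energies \<kappa> e"
    by (rule resonant_energies_exist[OF \<kappa>])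
  fix e assume "resonant_energies \<kappa> e"
  from resonant_energies_values[OF \<kappa> this]
  show "e 1 = 4 * \<kappa>" "e 2 = 4 * \<kappa> - 2" "\<And>m. m \<ge> 3 \<Longrightarrow> neutrally_stable \<kappa> (e m)"
    by auto
qed

end
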